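(* Let $\mathcal{A}$ be a unital $C^*$-algebra over $\mathbb{F}$, where $\mathbb{F}=\mathbb{R}$ or $\mathbb{C}$. Let $a\in\mathcal{A}$, let $\mathcal{B}$ be a subspace of $\mathcal{A}$, and let $b_0\in\mathcal{B}$. Then $b_0$ is a best approximation to $a$ in $\mathcal{B}$ if and only if there exists a state $\phi$ on $\mathcal{A}$ such that $$\phi((a-b_0)^*(a-b_0)) = \|a-b_0\|^2 \quad\text{and}\quad \phi(a^*b)=\phi(b_0^*b)\ \text{ for all } b\in\mathcal{B}.$$
   Context: $1_{\mathcal{A}}$ denotes the identity of $\mathcal{A}$. "Subspace" means $\mathbb{F}$-linear subspace (not assumed closed). $\mathrm{dist}(a,\mathcal{B})=\inf\{\|a-b\|: b\in\mathcal{B}\}$. An element $b_0\in\mathcal{B}$ is a best approximation to $a$ in $\mathcal{B}$ if $\|a-b_0\|=\mathrm{dist}(a,\mathcal{B})$. For $\mathbb{F}=\mathbb{C}$, a state on $\mathcal{A}$ is a positive linear functional $\phi$ on $\mathcal{A}$ (i.e. mapping positive elements to nonnegative reals) with $\phi(1_{\mathcal{A}})=1$; for $\mathbb{F}=\mathbb{R}$, it is additionally required that $\phi(c^* )=\phi(c)$ for all $c\in\mathcal{A}$. *)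

theory Defs
  imports "HOL-Analysis.Analysis"
begin

definition two_sided_unit :: "'a::ring_1 \<Rightarrow> bool" where
  "two_sided_unit x \<longleftrightarrow> (\<exists>y. x * y = 1 \<and> y * x = 1)"

text \<open>
  The C*-algebra is the whole type \<open>'a\<close>. The class \<open>real_normed_algebra_1\<close> includes
  \<open>norm 1 = 1\<close>, so the zero algebra (which has no states) is excluded; for a nonzero
  unital algebra \<open>norm 1 = 1\<close> already follows from the C*-identity.
\<close>

locale cstar_involution =
  fixes star :: "'a::{real_normed_algebra_1,banach} \<Rightarrow> 'a"
  assumes star_star: "star (star x) = x"
    and star_add: "star (x + y) = star x + star y"
    and star_mult: "star (x * y) = star y * star x"
    and cstar_identity: "norm (star x * x) = (norm x)\<^sup>2"

text \<open>
  Over the reals the C*-identity alone does not characterize the norm-closed *-algebras of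
  operators on Hilbert space (e.g. the complex numbers with the trivial involution satisfy it);
  the usual abstract definition of a real C*-algebra also requires every \<open>1 + x\<^sup>*x\<close> to be
  invertible. Over the complex numbers this is a theorem and is not assumed.
\<close>

locale unital_real_cstar_algebra = cstar_involution star
  for star :: "'a::{real_normed_algebra_1,banach} \<Rightarrow> 'a" +
  assumes star_scaleR: "star (r *\<^sub>R x) = r *\<^sub>R star x"
    and unit_one_plus: "two_sided_unit (1 + star x * x)"

locale unital_complex_cstar_algebra = cstar_involution star + vector_space scaleC
  for scaleC :: "complex \<Rightarrow> 'a::{real_normed_algebra_1,banach} \<Rightarrow> 'a"
    and star :: "'a \<Rightarrow> 'a" +
  assumes scaleC_of_real: "scaleC (complex_of_real r) x = r *\<^sub>R x"
    and scaleC_mult_left: "scaleC c x * y = scaleC c (x * y)"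
    and scaleC_mult_right: "x * scaleC c y = scaleC c (x * y)"
    and norm_scaleC: "norm (scaleC c x) = cmod c * norm x"
    and star_scaleC: "star (scaleC c x) = scaleC (cnj c) (star x)"

text \<open>
  The spectrum of an element of a real algebra is its spectrum in the complexification:
  \<open>x - (\<alpha> + i\<beta>)\<close> is invertible there iff \<open>(x - \<alpha>)\<^sup>2 + \<beta>\<^sup>2\<close> is invertible in the algebra.
\<close>

definition real_spectrum :: "'a::real_algebra_1 \<Rightarrow> complex set" where
  "real_spectrum x = {z. \<not> two_sided_unit ((x - of_real (Re z))\<^sup>2 + of_real ((Im z)\<^sup>2))}"

definition complex_spectrum :: "(complex \<Rightarrow> 'a::ring_1 \<Rightarrow> 'a) \<Rightarrow> 'a \<Rightarrow> complex set" where
  "complex_spectrum scaleC x = {z. \<not> two_sided_unit (x - scaleC z 1)}"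

definition real_positive :: "('a::real_algebra_1 \<Rightarrow> 'a) \<Rightarrow> 'a \<Rightarrow> bool" where
  "real_positive star x \<longleftrightarrow> star x = x \<and> real_spectrum x \<subseteq> \<real>\<^sub>\<ge>\<^sub>0"

definition complex_positive ::
  "(complex \<Rightarrow> 'a::ring_1 \<Rightarrow> 'a) \<Rightarrow> ('a \<Rightarrow> 'a) \<Rightarrow> 'a \<Rightarrow> bool" where
  "complex_positive scaleC star x \<longleftrightarrow> star x = x \<and> complex_spectrum scaleC x \<subseteq> \<real>\<^sub>\<ge>\<^sub>0"

definition real_state :: "('a::real_algebra_1 \<Rightarrow> 'a) \<Rightarrow> ('a \<Rightarrow> real) \<Rightarrow> bool" where
  "real_state star \<phi> \<longleftrightarrow>
     linear \<phi> \<and> (\<forall>x. real_positive star x \<longrightarrow> \<phi> x \<ge> 0) \<and> \<phi> 1 = 1 \<and> (\<forall>c. \<phi> (star c) = \<phi> c)"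

definition complex_state ::
  "(complex \<Rightarrow> 'a::ring_1 \<Rightarrow> 'a) \<Rightarrow> ('a \<Rightarrow> 'a) \<Rightarrow> ('a \<Rightarrow> complex) \<Rightarrow> bool" where
  "complex_state scaleC star \<phi> \<longleftrightarrow>
     Vector_Spaces.linear scaleC (*) \<phi> \<and>
     (\<forall>x. complex_positive scaleC star x \<longrightarrow> \<phi> x \<in> \<real>\<^sub>\<ge>\<^sub>0) \<and> \<phi> 1 = 1"

text \<open>The library's \<open>infdist a B\<close> is the infimum of \<open>norm (a - b)\<close> over \<open>b \<in> B\<close> for nonempty \<open>B\<close>.\<close>

definition best_approximation :: "'a::real_normed_vector \<Rightarrow> 'a set \<Rightarrow> 'a \<Rightarrow> bool" where
  "best_approximation a B b\<^sub>0 \<longleftrightarrow> b\<^sub>0 \<in> B \<and> norm (a - b\<^sub>0) = infdist a B"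

end

theory Submission
  imports Defs
begin

text \<open>
  Let \<open>u = a - b\<^sub>0\<close>. If \<open>\<phi>\<close> is a state as in the theorem then, states being contractive,
  \<open>(norm u)\<^sup>2 = \<phi> (u\<^sup>* (a - b)) \<le> norm u * norm (a - b)\<close> for all \<open>b \<in> B\<close>.
  Conversely, \<open>norm (1 + x\<^sup>*x) = 1 + (norm x)\<^sup>2\<close> and convexity show that \<open>v = 1 + u\<^sup>*u\<close> is at distance
  \<open>norm v\<close> from the real subspace of all \<open>u\<^sup>*b + b\<^sup>*u\<close>. A Hahn--Banach functional of norm one that
  vanishes on this subspace and norms \<open>v\<close> must norm both \<open>1\<close> and \<open>u\<^sup>*u\<close>, and its selfadjoint part
  is the required state.

  The C*-algebraic input is that the norm of a selfadjoint element is its spectral radius and that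
  \<open>x\<^sup>*x\<close> is positive. A complex C*-algebra is, by the latter, also a real one, and taking real parts
  matches its complex states with its real states.
\<close>

section \<open>Hahn--Banach extension\<close>

definition sublinear :: "('a::real_vector \<Rightarrow> real) \<Rightarrow> bool" where
  "sublinear q \<longleftrightarrow> (\<forall>x y. q (x + y) \<le> q x + q y) \<and> (\<forall>t x. t > 0 \<longrightarrow> q (t *\<^sub>R x) = t * q x)"

lemma sublinear_add: "sublinear q \<Longrightarrow> q (x + y) \<le> q x + q y"
  and sublinear_scaleR: "sublinear q \<Longrightarrow> t > 0 \<Longrightarrow> q (t *\<^sub>R x) = t * q x"
  by (auto simp: sublinear_def)

lemma sublinear_zero: "sublinear q \<Longrightarrow> q 0 = 0"
  using sublinear_scaleR[of q 2 0] by simp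

lemma sublinear_minus: "sublinear q \<Longrightarrow> - q (- x) \<le> q x"
  using sublinear_add[of q x "- x"] sublinear_zero[of q] by simp

lemma sublinearI_le:
  assumes "\<And>x y. q (x + y) \<le> q x + q y" and "\<And>t x. t > 0 \<Longrightarrow> q (t *\<^sub>R x) \<le> t * q x"
  shows "sublinear q"
proof -
  have "t * q x \<le> q (t *\<^sub>R x)" if "t > 0" for t x
    using assms(2)[of "1 / t" "t *\<^sub>R x"] that by (simp add: field_simps)
  then show ?thesis
    using assms by (force simp: sublinear_def intro: antisym)
qed

text \<open>A pair \<open>(k, s)\<close> in \<open>K\<close> stands for the demand
  \<open>f k \<ge> s\<close> on a linear \<open>f\<close> below \<open>q\<close>. The linear
  functionals below \<open>q'\<close> are exactly those below \<open>q\<close> that meet all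
  demands. \<open>Kle\<close> says that no demand exceeds what \<open>q\<close> permits.\<close>

lemma sublinear_cone_inf:
  fixes q :: "'a::real_vector \<Rightarrow> real" and K :: "('a \<times> real) set"
  assumes q: "sublinear q"
    and K0: "0 \<in> K" and Kadd: "\<And>k l. k \<in> K \<Longrightarrow> l \<in> K \<Longrightarrow> k + l \<in> K"
    and Kscale: "\<And>t k. t > 0 \<Longrightarrow> k \<in> K \<Longrightarrow> t *\<^sub>R k \<in> K"
    and Kle: "\<And>k s. (k, s) \<in> K \<Longrightarrow> s \<le> q k"
  defines "q' \<equiv> \<lambda>x. INF k\<in>K. q (x + fst k) - snd k"
  shows "sublinear q'" and "\<And>x k s. (k, s) \<in> K \<Longrightarrow> q' x \<le> q (x + k) - s"
proof -
  \<comment> \<open>A real infimum obeys its laws only for sets bounded below; \<open>Kle\<close>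
    and subadditivity give the bound \<open>- q (- x)\<close>.\<close>
  have bdd: "bdd_below ((\<lambda>k. q (x + fst k) - snd k) ` K)" for x
  proof (rule bdd_belowI2)
    fix k assume "k \<in> K"
    then have "snd k \<le> q (fst k)"
      using Kle[of "fst k" "snd k"] by simp
    then show "- q (- x) \<le> q (x + fst k) - snd k"
      using sublinear_add[OF q, of "x + fst k" "- x"] by simp
  qed
  have lower: "q' x \<le> q (x + fst k) - snd k" if "k \<in> K" for x k
    unfolding q'_def by (rule cINF_lower[OF bdd that])
  then show "\<And>x k s. (k, s) \<in> K \<Longrightarrow> q' x \<le> q (x + k) - s"
    by fastforce
  have greatest: "c \<le> q' x" if "\<And>k. k \<in> K \<Longrightarrow> c \<le> q (x + fst k) - snd k" for c x
    unfolding q'_def using K0 that by (intro cINF_greatest) auto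
  show "sublinear q'"
  proof (rule sublinearI_le)
    fix x y
    have step: "q' (x + y) \<le> (q (x + fst k) - snd k) + (q (y + fst l) - snd l)"
      if "k \<in> K" "l \<in> K" for k l
      using lower[OF Kadd[OF that], of "x + y"] sublinear_add[OF q, of "x + fst k" "y + fst l"]
      by (simp add: algebra_simps)
    have "q' (x + y) - q' y \<le> q' x"
    proof (rule greatest)
      fix k assume k: "k \<in> K"
      have "q' (x + y) - (q (x + fst k) - snd k) \<le> q' y"
        by (rule greatest) (use step[OF k] in force)
      then show "q' (x + y) - q' y \<le> q (x + fst k) - snd k" by simp
    qed
    then show "q' (x + y) \<le> q' x + q' y" by simp
  next
    fix t :: real and x assume t: "t > 0"
    have "q' (t *\<^sub>R x) / t \<le> q' x"
    proof (rule greatest)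
      fix k assume k: "k \<in> K"
      have "q' (t *\<^sub>R x) \<le> q (t *\<^sub>R (x + fst k)) - t * snd k"
        using lower[OF Kscale[OF t k], of "t *\<^sub>R x"] by (simp add: scaleR_add_right)
      also have "\<dots> = t * (q (x + fst k) - snd k)"
        by (simp only: sublinear_scaleR[OF q t] right_diff_distrib)
      finally show "q' (t *\<^sub>R x) / t \<le> q (x + fst k) - snd k"
        using t by (simp add: divide_le_eq mult.commute)
    qed
    then show "q' (t *\<^sub>R x) \<le> t * q' x"
      using t by (simp add: divide_le_eq mult.commute)
  qed
qed

text \<open>Zorn's lemma yields a minimal sublinear functional below \<open>p\<close>. Minimality
  forces it to be odd, and an odd sublinear functional is linear.\<close>

lemma sublinear_linear_below:
  fixes p :: "'a::real_vector \<Rightarrow> real"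
  assumes p: "sublinear p"
  obtains f where "linear f" and "\<And>x. f x \<le> p x"
proof -
  define S where "S = {q. sublinear q \<and> q \<le> p}"
  have S_lower: "- p (- x) \<le> q x" if "q \<in> S" for q x
  proof -
    have "sublinear q" "q (- x) \<le> p (- x)"
      using that by (auto simp: S_def le_fun_def)
    then show ?thesis
      using sublinear_minus[of q x] by linarith
  qed
  \<comment> \<open>The order is reversed, so the maximal element supplied by Zorn's lemma is a
    minimal functional.\<close>
  define P where "P = (\<lambda>f g :: 'a \<Rightarrow> real. g \<le> f)"
  have "\<exists>m\<in>S. \<forall>a\<in>S. P m a \<longrightarrow> a = m"
  proof (rule predicate_Zorn)
    show "partial_order_on S (relation_of P S)"
      by (rule partial_order_on_relation_ofI) (auto simp: P_def)
    fix C assume C: "C \<in> Chains (relation_of P S)"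
    then have CS: "C \<subseteq> S" and chain: "\<And>f g. f \<in> C \<Longrightarrow> g \<in> C \<Longrightarrow> f \<le> g \<or> g \<le> f"
      by (auto simp: Chains_def relation_of_def P_def)
    show "\<exists>u\<in>S. \<forall>a\<in>C. P a u"
    proof (cases "C = {}")
      case True
      then show ?thesis using p by (auto simp: S_def)
    next
      case False
      define q where "q = (\<lambda>x. INF f\<in>C. f x)"
      have lower: "q x \<le> f x" if "f \<in> C" for f x
        unfolding q_def using that CS S_lower by (intro cINF_lower bdd_belowI2) auto
      have greatest: "c \<le> q x" if "\<And>f. f \<in> C \<Longrightarrow> c \<le> f x" for c x
        unfolding q_def using False that by (intro cINF_greatest) auto
      have sub: "sublinear f" if "f \<in> C" for f
        using CS that by (auto simp: S_def)
      have "sublinear q"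
      proof (rule sublinearI_le)
        fix x y
        have step: "q (x + y) \<le> f x + g y" if fg: "f \<in> C" "g \<in> C" for f g
        proof -
          \<comment> \<open>Two members of a chain have a common lower bound in it, so subadditivity
            of that one member covers different choices at \<open>x\<close> and
            \<open>y\<close>.\<close>
          obtain k where k: "k \<in> C" "k \<le> f" "k \<le> g"
            using chain[OF fg] fg by blast
          have "q (x + y) \<le> k x + k y"
            using lower[OF k(1), of "x + y"] sublinear_add[OF sub[OF k(1)], of x y] by linarith
          also have "\<dots> \<le> f x + g y"
            using k by (intro add_mono) (auto simp: le_fun_def)
          finally show ?thesis .
        qed
        have "q (x + y) - q y \<le> q x"
        proof (rule greatest)
          fix f assume f: "f \<in> C"
          have "q (x + y) - f x \<le> q y"
            by (rule greatest) (use step[OF f] in force)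
          then show "q (x + y) - q y \<le> f x" by simp
        qed
        then show "q (x + y) \<le> q x + q y" by simp
      next
        fix t :: real and x assume t: "t > 0"
        have "q (t *\<^sub>R x) / t \<le> q x"
        proof (rule greatest)
          fix f assume f: "f \<in> C"
          show "q (t *\<^sub>R x) / t \<le> f x"
            using lower[OF f, of "t *\<^sub>R x"] sublinear_scaleR[OF sub[OF f] t] t
            by (simp add: divide_le_eq mult.commute)
        qed
        then show "q (t *\<^sub>R x) \<le> t * q x"
          using t by (simp add: divide_le_eq mult.commute)
      qed
      moreover have "q \<le> p"
      proof -
        obtain f where "f \<in> C" using False by blast
        then have "q \<le> f" "f \<le> p"
          using lower CS by (auto simp: S_def le_fun_def)
        then show ?thesis by (rule order_trans)
      qed
      ultimately have "q \<in> S" by (simp add: S_def)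
      then show ?thesis
        using lower by (auto simp: P_def le_fun_def)
    qed
  qed
  then obtain q where q: "q \<in> S" and min: "\<And>a. a \<in> S \<Longrightarrow> a \<le> q \<Longrightarrow> a = q"
    by (auto simp: P_def)
  have sq: "sublinear q" and qp: "q \<le> p"
    using q by (auto simp: S_def)
  have neg: "q (- y) = - q y" for y
  proof -
    \<comment> \<open>This cone demands the value \<open>q y\<close> at \<open>y\<close>. By
      minimality the lowered functional is \<open>q\<close> itself, which gives
      \<open>q (- y) \<le> - q y\<close>.\<close>
    define K where "K = {(t *\<^sub>R y, t * q y) | t. t \<ge> 0}"
    define q' where "q' = (\<lambda>x. INF k\<in>K. q (x + fst k) - snd k)"
    have K0: "0 \<in> K"
      by (auto simp: K_def zero_prod_def intro!: exI[of _ 0])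
    have Ka: "k + l \<in> K" if "k \<in> K" "l \<in> K" for k l
    proof -
      obtain t u where "k = (t *\<^sub>R y, t * q y)" "l = (u *\<^sub>R y, u * q y)" "t \<ge> 0" "u \<ge> 0"
        using \<open>k \<in> K\<close> \<open>l \<in> K\<close> by (auto simp: K_def)
      then show ?thesis
        by (auto simp: K_def algebra_simps intro!: exI[of _ "t + u"])
    qed
    have Ks: "t *\<^sub>R k \<in> K" if "t > 0" "k \<in> K" for t k
    proof -
      obtain u where "k = (u *\<^sub>R y, u * q y)" "u \<ge> 0"
        using \<open>k \<in> K\<close> by (auto simp: K_def)
      then show ?thesis
        using \<open>t > 0\<close> by (auto simp: K_def intro!: exI[of _ "t * u"])
    qed
    have Kl: "s \<le> q k" if ks: "(k, s) \<in> K" for k s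
    proof -
      obtain t where t: "k = t *\<^sub>R y" "s = t * q y" "t \<ge> 0"
        using ks by (auto simp: K_def)
      then show ?thesis
        using sublinear_zero[OF sq] sublinear_scaleR[OF sq, of t y] by (cases "t = 0") auto
    qed
    have q'sub: "sublinear q'" and q'le: "\<And>x k s. (k, s) \<in> K \<Longrightarrow> q' x \<le> q (x + k) - s"
      using sublinear_cone_inf[OF sq K0 Ka Ks Kl] unfolding q'_def by blast+
    have "q' \<le> q"
      using q'le[of 0 0] K0 by (simp add: le_fun_def zero_prod_def)
    then have "q' = q"
      using min[of q'] q'sub qp by (auto simp: S_def)
    moreover have "(y, q y) \<in> K"
      by (auto simp: K_def intro!: exI[of _ 1])
    ultimately have "q (- y) \<le> - q y"
      using q'le[of y "q y" "- y"] sublinear_zero[OF sq] by simp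
    then show ?thesis
      using sublinear_minus[OF sq, of y] by linarith
  qed
  have "linear q"
  proof (rule linearI)
    fix x y
    show "q (x + y) = q x + q y"
      using sublinear_add[OF sq, of x y] sublinear_add[OF sq, of "x + y" "- y"] neg[of y] by simp
  next
    fix t :: real and x
    consider "t > 0" | "t = 0" | "t < 0" by linarith
    then show "q (t *\<^sub>R x) = t *\<^sub>R q x"
    proof cases
      case 3
      then show ?thesis
        using sublinear_scaleR[OF sq, of "- t" x] neg[of "t *\<^sub>R x"] by simp
    qed (simp_all add: sublinear_zero[OF sq] sublinear_scaleR[OF sq])
  qed
  then show ?thesis
    using that qp by (auto simp: le_fun_def)
qed

text \<open>The cone \<open>K\<close> demands \<open>f (t v + w) \<ge> t * norm v\<close>. The case
  \<open>t = 1\<close>, \<open>w = 0\<close> makes \<open>f\<close> norm \<open>v\<close>; the case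
  \<open>t = 0\<close>, applied to \<open>w\<close> and \<open>- w\<close>, makes it vanish on
  \<open>W\<close>. After division by \<open>t\<close>, the distance hypothesis says that the norm
  permits these demands.\<close>

lemma norming_functional_vanishing_on_subspace:
  fixes v :: "'a::real_normed_vector"
  assumes W: "subspace W" and le: "\<And>w. w \<in> W \<Longrightarrow> norm v \<le> norm (v + w)"
  obtains f where "linear f" and "\<And>x. \<bar>f x\<bar> \<le> norm x" and "f v = norm v"
    and "\<And>w. w \<in> W \<Longrightarrow> f w = 0"
proof -
  define K where "K = {(t *\<^sub>R v + w, t * norm v) | t w. t \<ge> 0 \<and> w \<in> W}"
  define q where "q = (\<lambda>x. INF k\<in>K. norm (x + fst k) - snd k)"
  have norm: "sublinear (norm :: 'a \<Rightarrow> real)"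
    by (simp add: sublinear_def norm_triangle_ineq)
  have KI: "(t *\<^sub>R v + w, t * norm v) \<in> K" if "t \<ge> 0" "w \<in> W" for t w
    using that by (auto simp: K_def)
  have W0: "0 \<in> W" using W by (rule subspace_0)
  have K0: "0 \<in> K"
    using KI[of 0 0] W0 by (simp add: zero_prod_def)
  have Ka: "k + l \<in> K" if "k \<in> K" "l \<in> K" for k l
  proof -
    obtain t u w z where "k = (t *\<^sub>R v + w, t * norm v)" "l = (u *\<^sub>R v + z, u * norm v)"
      "t \<ge> 0" "u \<ge> 0" "w \<in> W" "z \<in> W"
      using \<open>k \<in> K\<close> \<open>l \<in> K\<close> by (auto simp: K_def)
    then show ?thesis
      using KI[of "t + u" "w + z"] subspace_add[OF W, of w z] by (simp add: algebra_simps)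
  qed
  have Ks: "t *\<^sub>R k \<in> K" if "t > 0" "k \<in> K" for t k
  proof -
    obtain u w where "k = (u *\<^sub>R v + w, u * norm v)" "u \<ge> 0" "w \<in> W"
      using \<open>k \<in> K\<close> by (auto simp: K_def)
    then show ?thesis
      using \<open>t > 0\<close> KI[of "t * u" "t *\<^sub>R w"] subspace_scale[OF W, of w t]
      by (simp add: scaleR_add_right mult.assoc)
  qed
  have Kl: "s \<le> norm k" if ks: "(k, s) \<in> K" for k s
  proof -
    obtain t w where t: "k = t *\<^sub>R v + w" "s = t * norm v" "t \<ge> 0" "w \<in> W"
      using ks by (auto simp: K_def)
    show ?thesis
    proof (cases "t = 0")
      case False
      then have "k = t *\<^sub>R (v + (1 / t) *\<^sub>R w)"
        using t by (simp add: scaleR_add_right)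
      then have "norm k = t * norm (v + (1 / t) *\<^sub>R w)"
        using t by simp
      then show ?thesis
        using le[OF subspace_scale[OF W t(4), of "1 / t"]] t by (simp add: mult_left_mono)
    qed (use t in simp)
  qed
  have qsub: "sublinear q" and qle: "\<And>x k s. (k, s) \<in> K \<Longrightarrow> q x \<le> norm (x + k) - s"
    using sublinear_cone_inf[OF norm K0 Ka Ks Kl] unfolding q_def by blast+
  obtain f where f: "linear f" and fq: "\<And>x. f x \<le> q x"
    using sublinear_linear_below[OF qsub] by blast
  have le: "f x \<le> norm x" for x
    using fq[of x] qle[of 0 0 x] K0 by (simp add: zero_prod_def)
  show thesis
  proof
    show "linear f" by fact
    show "\<bar>f x\<bar> \<le> norm x" for x
      using le[of x] le[of "- x"] linear_neg[OF f, of x] by auto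
    have "f (- v) \<le> - norm v"
      using fq[of "- v"] qle[OF KI[of 1 0], of "- v"] W0 by simp
    then show "f v = norm v"
      using le[of v] linear_neg[OF f, of v] by simp
    show "f w = 0" if w: "w \<in> W" for w
    proof -
      have "f x \<le> 0" if "x \<in> W" for x
        using fq[of x] qle[OF KI[of 0 "- x"], of x] subspace_neg[OF W that] by simp
      from this[OF w] this[OF subspace_neg[OF W w]] show ?thesis
        by (simp add: linear_neg[OF f])
    qed
  qed
qed

section \<open>Units and the spectral radius in Banach algebras\<close>

lemma two_sided_unitI: "x * y = 1 \<Longrightarrow> y * x = 1 \<Longrightarrow> two_sided_unit x"
  by (auto simp: two_sided_unit_def)

lemma two_sided_unitI_left_right:
  assumes "y * x = 1" "x * z = 1"
  shows "two_sided_unit x"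
proof -
  have "y = y * (x * z)" by (simp add: assms(2))
  also have "\<dots> = z" by (simp add: mult.assoc[symmetric] assms(1))
  finally show ?thesis using assms by (auto simp: two_sided_unit_def)
qed

lemma two_sided_unit_mult:
  assumes "two_sided_unit x" "two_sided_unit y"
  shows "two_sided_unit (x * y)"
proof -
  obtain u v where "x * u = 1" "u * x = 1" "y * v = 1" "v * y = 1"
    using assms by (auto simp: two_sided_unit_def)
  moreover have "(x * y) * (v * u) = x * (y * v) * u" "(v * u) * (x * y) = v * (u * x) * y"
    by (simp_all only: mult.assoc)
  ultimately have "(x * y) * (v * u) = 1" "(v * u) * (x * y) = 1"
    by simp_all
  then show ?thesis by (rule two_sided_unitI)
qed

text \<open>If \<open>z\<close> inverts the product, then \<open>z * y\<close> is a left and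
  \<open>y * z\<close> a right inverse of \<open>x\<close>.\<close>

lemma two_sided_unit_factor:
  assumes "two_sided_unit (x * y)" "x * y = y * x"
  shows "two_sided_unit x"
proof -
  obtain z where "(x * y) * z = 1" "z * (x * y) = 1"
    using assms by (auto simp: two_sided_unit_def)
  then have "(z * y) * x = 1" "x * (y * z) = 1"
    by (simp add: assms(2) mult.assoc, simp add: mult.assoc)
  then show ?thesis by (rule two_sided_unitI_left_right)
qed

lemma two_sided_unit_scaleR_iff:
  fixes x :: "'a::real_algebra_1"
  assumes "c \<noteq> 0"
  shows "two_sided_unit (c *\<^sub>R x) \<longleftrightarrow> two_sided_unit x"
proof -
  have *: "two_sided_unit (c *\<^sub>R x)" if "two_sided_unit x" "c \<noteq> 0" for c and x :: 'a
  proof -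
    obtain y where "x * y = 1" "y * x = 1"
      using \<open>two_sided_unit x\<close> by (auto simp: two_sided_unit_def)
    then show ?thesis
      using \<open>c \<noteq> 0\<close> by (intro two_sided_unitI[of _ "(1 / c) *\<^sub>R y"]) simp_all
  qed
  show ?thesis
    using *[of x c] *[of "c *\<^sub>R x" "1 / c"] assms by auto
qed

lemma two_sided_unit_minus_iff:
  fixes x :: "'a::real_algebra_1"
  shows "two_sided_unit (- x) \<longleftrightarrow> two_sided_unit x"
  using two_sided_unit_scaleR_iff[of "-1" x] by simp

text \<open>If \<open>g\<close> inverts \<open>1 - x * y\<close>, then \<open>1 + y * g * x\<close>
  inverts \<open>1 - y * x\<close>, as comparing the two geometric series suggests. Hence
  \<open>x * y\<close> and \<open>y * x\<close> have the same nonzero spectrum.\<close>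

lemma two_sided_unit_one_minus_swap:
  fixes x y :: "'a::ring_1"
  assumes "two_sided_unit (1 - x * y)"
  shows "two_sided_unit (1 - y * x)"
proof -
  obtain g where g: "(1 - x * y) * g = 1" "g * (1 - x * y) = 1"
    using assms by (auto simp: two_sided_unit_def)
  then have "x * y * g = g - 1" "g * x * y = g - 1"
    by (simp_all add: algebra_simps)
  then have *: "x * (y * (g * x)) = g * x - x" "g * (x * (y * x)) = g * x - x"
    by (simp_all add: mult.assoc[symmetric] left_diff_distrib)
  show ?thesis
    by (rule two_sided_unitI[of _ "1 + y * g * x"]) (simp_all add: algebra_simps *)
qed

lemma two_sided_unit_one_minus:
  fixes x :: "'a::{real_normed_algebra_1,banach}"
  assumes "norm x < 1"
  shows "two_sided_unit (1 - x)"
proof -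
  have sm: "summable (\<lambda>n. x ^ n)"
  proof (rule summable_norm_cancel, rule summable_comparison_test')
    show "summable (\<lambda>n. norm x ^ n)"
      using assms by (simp add: summable_geometric)
    show "norm (norm (x ^ n)) \<le> norm x ^ n" if "n \<ge> 0" for n
      by (simp add: norm_power_ineq)
  qed
  have tel: "(\<lambda>n. x ^ n - x ^ Suc n) sums (x ^ 0 - 0)"
    by (rule telescope_sums') (rule LIMSEQ_power_zero[OF assms])
  have "(1 - x) * (\<Sum>n. x ^ n) = (\<Sum>n. (1 - x) * x ^ n)"
    by (rule suminf_mult[OF sm, symmetric])
  also have "\<dots> = 1"
    using sums_unique[OF tel] by (simp add: algebra_simps)
  finally have 1: "(1 - x) * (\<Sum>n. x ^ n) = 1" .
  have "(\<Sum>n. x ^ n) * (1 - x) = (\<Sum>n. x ^ n * (1 - x))"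
    by (rule suminf_mult2[OF sm])
  also have "\<dots> = 1"
    using sums_unique[OF tel] by (simp add: algebra_simps power_commutes)
  finally show ?thesis
    using 1 by (intro two_sided_unitI)
qed

lemma two_sided_unit_scaleR_one_minus:
  fixes x :: "'a::{real_normed_algebra_1,banach}"
  assumes "norm x < t"
  shows "two_sided_unit (t *\<^sub>R 1 - x)"
proof -
  have t: "t > 0" using assms norm_ge_zero[of x] by linarith
  have "two_sided_unit (1 - (1 / t) *\<^sub>R x)"
    using assms t by (intro two_sided_unit_one_minus) (simp add: field_simps)
  then have "two_sided_unit (t *\<^sub>R (1 - (1 / t) *\<^sub>R x))"
    using t by (simp add: two_sided_unit_scaleR_iff)
  then show ?thesis using t by (simp add: scaleR_diff_right)
qed

text \<open>For a non-unit the chosen value is unspecified.\<close>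

definition unit_inverse :: "'a::ring_1 \<Rightarrow> 'a" where
  "unit_inverse x = (SOME y. x * y = 1 \<and> y * x = 1)"

lemma unit_inverse:
  assumes "two_sided_unit x"
  shows "x * unit_inverse x = 1" "unit_inverse x * x = 1"
  using someI_ex[OF assms[unfolded two_sided_unit_def]] by (simp_all add: unit_inverse_def)

lemma unit_inverse_unique:
  assumes "x * y = 1" "y * x = 1"
  shows "unit_inverse x = y"
proof -
  have "unit_inverse x = (y * x) * unit_inverse x" using assms by simp
  also have "\<dots> = y"
    using unit_inverse(1)[OF two_sided_unitI[OF assms]] by (simp add: mult.assoc)
  finally show ?thesis .
qed

lemma unit_inverse_commute:
  assumes "two_sided_unit x" "x * y = y * x"
  shows "unit_inverse x * y = y * unit_inverse x"
proof -
  have "unit_inverse x * y = unit_inverse x * (y * x) * unit_inverse x"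
    using unit_inverse(1)[OF assms(1)] by (simp add: mult.assoc)
  also have "\<dots> = (unit_inverse x * x) * y * unit_inverse x"
    by (simp add: assms(2)[symmetric] mult.assoc)
  finally show ?thesis by (simp add: unit_inverse(2)[OF assms(1)])
qed

lemma continuous_on_unit_inverse:
  fixes f :: "'b::topological_space \<Rightarrow> 'a::real_normed_algebra_1"
  assumes cont: "continuous_on S f" and unit: "\<And>s. s \<in> S \<Longrightarrow> two_sided_unit (f s)"
  shows "continuous_on S (\<lambda>s. unit_inverse (f s))"
  unfolding continuous_on_def
proof
  fix s assume s: "s \<in> S"
  define g where "g = (\<lambda>s. unit_inverse (f s))"
  define N where "N = norm (g s)"
  have lim: "((\<lambda>r. norm (f r - f s)) \<longlongrightarrow> 0) (at s within S)"
  proof (rule tendsto_norm_zero, rule LIM_zero)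
    show "(f \<longlongrightarrow> f s) (at s within S)"
      using cont s by (simp add: continuous_on_def)
  qed
  have resolvent: "norm (g r - g s) \<le> norm (g r) * norm (f r - f s) * N" if "r \<in> S" for r
  proof -
    \<comment> \<open>This is the resolvent identity; it still contains \<open>g r\<close>, which
      has to be bounded near \<open>s\<close>.\<close>
    have "g r - g s = g r * (f s * g s) - (g r * f r) * g s"
      using unit_inverse[OF unit[OF s]] unit_inverse[OF unit[OF that]] by (simp add: g_def)
    also have "\<dots> = g r * (f s - f r) * g s"
      by (simp add: algebra_simps)
    finally have "norm (g r - g s) \<le> norm (g r) * norm (f s - f r) * N"
      unfolding N_def
      by simp (rule order_trans[OF norm_mult_ineq mult_right_mono[OF norm_mult_ineq norm_ge_zero]])
    then show ?thesis by (simp add: norm_minus_commute)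
  qed
  have "((\<lambda>r. norm (f r - f s) * N) \<longlongrightarrow> 0) (at s within S)"
    using tendsto_mult_left_zero[OF lim] by simp
  then have "eventually (\<lambda>r. norm (f r - f s) * N < 1 / 2) (at s within S)"
    by (rule order_tendstoD) simp
  moreover have "eventually (\<lambda>r. r \<in> S) (at s within S)"
    by (simp add: eventually_at_filter)
  ultimately have "eventually (\<lambda>r. norm (g r - g s) \<le> 2 * N * N * norm (f r - f s)) (at s within S)"
  proof eventually_elim
    case (elim r)
    \<comment> \<open>Once \<open>norm (f r - f s) * N < 1 / 2\<close>, half of
      \<open>norm (g r)\<close> can be absorbed on the left, leaving the bound
      \<open>2 * N\<close>.\<close>
    have "norm (g r) \<le> N + norm (g r - g s)"
      unfolding N_def using norm_triangle_ineq[of "g s" "g r - g s"] by simp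
    also have "\<dots> \<le> N + norm (g r) * (norm (f r - f s) * N)"
      using resolvent[OF elim(2)] by (simp add: mult.assoc)
    also have "\<dots> \<le> N + norm (g r) * (1 / 2)"
      using elim(1) by (intro add_left_mono mult_left_mono) auto
    finally have "norm (g r) \<le> 2 * N" by simp
    then have "norm (g r) * (norm (f r - f s) * N) \<le> 2 * N * (norm (f r - f s) * N)"
      by (intro mult_right_mono) (auto simp: N_def)
    then show ?case using resolvent[OF elim(2)] by (simp add: mult_ac)
  qed
  then have "((\<lambda>r. g r - g s) \<longlongrightarrow> 0) (at s within S)"
    by (rule Lim_null_comparison) (rule tendsto_mult_right_zero[OF lim])
  then show "((\<lambda>s. unit_inverse (f s)) \<longlongrightarrow> unit_inverse (f s)) (at s within S)"
    unfolding g_def by (rule LIM_zero_cancel)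
qed

section \<open>Poisson kernels and norms of repeated squares\<close>

text \<open>
  For real \<open>x\<close> and \<open>c = cos \<theta>\<close> these are \<open>\<bar>1 - e\<^sup>i\<^sup>\<theta> x\<bar>\<^sup>2\<close> and \<open>Re ((1 + e\<^sup>i\<^sup>\<theta> x) / (1 - e\<^sup>i\<^sup>\<theta> x))\<close>, so that
  \<open>2 c\<^sup>2 - 1\<close> stands for the doubled angle and \<open>- c\<close> for the opposite point of the circle.
\<close>

definition poisson_denom :: "real \<Rightarrow> 'a::real_algebra_1 \<Rightarrow> 'a" where
  "poisson_denom c x = 1 - (2 * c) *\<^sub>R x + x * x"

definition poisson_kernel :: "real \<Rightarrow> 'a::real_algebra_1 \<Rightarrow> 'a" where
  "poisson_kernel c x = (1 - x * x) * unit_inverse (poisson_denom c x)"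

lemma poisson_denom_commute: "poisson_denom c x * poisson_denom d x = poisson_denom d x * poisson_denom c x"
  by (simp add: poisson_denom_def algebra_simps)

text \<open>For real \<open>x\<close> and w = exp(i \<theta>) x this is the squared modulus of 1 -
  w^2 = (1 - w)(1 + w).\<close>

lemma poisson_denom_double:
  "poisson_denom (2 * c\<^sup>2 - 1) (x * x) = poisson_denom c x * poisson_denom (- c) x"
  by (simp add: poisson_denom_def algebra_simps power2_eq_square)
    (simp add: scaleR_add_left[symmetric] scaleR_2)

text \<open>With w as above, (1 + w^2)/(1 - w^2) is the mean of (1 + w)/(1 - w) and (1 - w)/(1 + w).
  In terms of the denominators \<open>A\<close> and \<open>B\<close> the point is
  \<open>A + B = 2 *\<^sub>R (1 + x * x)\<close>.\<close>

lemma poisson_kernel_double: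
  assumes u: "two_sided_unit (poisson_denom c x)" and v: "two_sided_unit (poisson_denom (- c) x)"
  shows "poisson_kernel (2 * c\<^sup>2 - 1) (x * x) = (1 / 2) *\<^sub>R (poisson_kernel c x + poisson_kernel (- c) x)"
proof -
  define A where "A = poisson_denom c x"
  define B where "B = poisson_denom (- c) x"
  define g where "g = unit_inverse A"
  define h where "h = unit_inverse B"
  have g: "A * g = 1" "g * A = 1" and h: "B * h = 1" "h * B = 1"
    using unit_inverse[OF u] unit_inverse[OF v] by (simp_all add: g_def h_def A_def B_def)
  have gB: "g * B = B * g"
    using unit_inverse_commute[OF u poisson_denom_commute] by (simp add: g_def A_def B_def)
  have gh: "g * h = h * g"
    using unit_inverse_commute[OF v, of g] gB by (simp add: h_def B_def)
  have "unit_inverse (A * B) = h * g"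
  proof (rule unit_inverse_unique)
    have "A * B * (h * g) = A * (B * h) * g" "h * g * (A * B) = h * (g * A) * B"
      by (simp_all only: mult.assoc)
    then show "A * B * (h * g) = 1" "h * g * (A * B) = 1"
      by (simp_all add: g h)
  qed
  then have inv: "unit_inverse (poisson_denom (2 * c\<^sup>2 - 1) (x * x)) = h * g"
    by (simp add: poisson_denom_double A_def B_def)
  have AB: "(A + B) * (h * g) = g + h"
  proof -
    have "A * (h * g) = h"
      by (simp add: gh[symmetric] mult.assoc[symmetric] g(1))
    moreover have "B * (h * g) = g"
      by (simp add: mult.assoc[symmetric] h(1))
    ultimately show ?thesis by (simp add: distrib_right add.commute)
  qed
  have "A + B = 2 *\<^sub>R (1 + x * x)"
    by (simp add: A_def B_def poisson_denom_def scaleR_add_right scaleR_2)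
  then have "1 + x * x = (1 / 2) *\<^sub>R (A + B)" by simp
  moreover have "1 - x * x * (x * x) = (1 - x * x) * (1 + x * x)"
    by (simp add: algebra_simps)
  ultimately have "1 - x * x * (x * x) = (1 - x * x) * ((1 / 2) *\<^sub>R (A + B))"
    by simp
  then have "poisson_kernel (2 * c\<^sup>2 - 1) (x * x) = (1 / 2) *\<^sub>R ((1 - x * x) * ((A + B) * (h * g)))"
    by (simp add: poisson_kernel_def inv mult.assoc)
  then show ?thesis
    unfolding AB by (simp add: poisson_kernel_def distrib_left g_def h_def A_def B_def)
qed

text \<open>
  By the doubling formula, the uniform distance over \<open>c\<close> of the kernels of \<open>(r x)\<^sup>n\<close> and \<open>x\<^sup>n\<close>, for
  \<open>n = 2\<^sup>m\<close>, does not increase with \<open>m\<close>. It is small if \<open>r < 1\<close> is close to 1, while the kernel of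
  \<open>(r x)\<^sup>n\<close> tends to 1; so the kernel of \<open>x\<^sup>n\<close> gets close to 1, which forces \<open>x\<^sup>n\<close> to be small.
\<close>
lemma norm_power_two_power_less_one:
  fixes x :: "'a::{real_normed_algebra_1,banach}"
  assumes unit: "\<And>c r. \<bar>c\<bar> \<le> 1 \<Longrightarrow> 0 \<le> r \<Longrightarrow> r \<le> 1 \<Longrightarrow> two_sided_unit (poisson_denom c (r *\<^sub>R x))"
    and x: "norm x \<le> 1"
  obtains m where "norm (x ^ 2 ^ m) < 1"
proof -
  define S :: "(real \<times> real) set" where "S = {-1..1} \<times> {0..1}"
  define F where "F = (\<lambda>p. poisson_kernel (fst p) (snd p *\<^sub>R x))"
  have "continuous_on S (\<lambda>p. unit_inverse (poisson_denom (fst p) (snd p *\<^sub>R x)))"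
    using unit by (intro continuous_on_unit_inverse)
      (auto simp: S_def poisson_denom_def intro!: continuous_intros)
  then have "continuous_on S F"
    unfolding F_def poisson_kernel_def by (intro continuous_intros)
  moreover have "compact S"
    unfolding S_def by (intro compact_Times compact_Icc)
  ultimately have "uniformly_continuous_on S F"
    by (rule compact_uniformly_continuous)
  then obtain d where d: "d > 0"
    and unif: "\<And>p q. p \<in> S \<Longrightarrow> q \<in> S \<Longrightarrow> dist p q < d \<Longrightarrow> dist (F p) (F q) < 1 / 4"
    unfolding uniformly_continuous_on_def by (metis zero_less_divide_1_iff zero_less_numeral)
  \<comment> \<open>This \<open>r\<close> lies in [0,1) and within \<open>d\<close> of 1, so the
    kernels of \<open>r *\<^sub>R x\<close> and \<open>x\<close> differ by less than 1/4 for every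
    \<open>c\<close>.\<close>
  define r where "r = max 0 (1 - d / 2)"
  have r: "0 \<le> r" "r < 1" "\<bar>r - 1\<bar> < d"
    using d by (auto simp: r_def)
  define y where "y = r *\<^sub>R x"
  have close: "two_sided_unit (poisson_denom c (y ^ 2 ^ m)) \<and> two_sided_unit (poisson_denom c (x ^ 2 ^ m)) \<and>
    norm (poisson_kernel c (y ^ 2 ^ m) - poisson_kernel c (x ^ 2 ^ m)) \<le> 1 / 4" if "\<bar>c\<bar> \<le> 1" for c m
    using that
  proof (induction m arbitrary: c)
    case 0
    have "dist (F (c, r)) (F (c, 1)) < 1 / 4"
      using 0 r by (intro unif) (auto simp: S_def dist_Pair_Pair dist_real_def)
    then have "norm (poisson_kernel c y - poisson_kernel c x) \<le> 1 / 4"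
      by (simp add: F_def y_def dist_norm)
    then show ?case
      using unit[OF 0, of r] unit[OF 0, of 1] r by (simp add: y_def)
  next
    case (Suc m)
    \<comment> \<open>The cosine of the half angle: doubling leads from both \<open>e\<close> and
      \<open>- e\<close> to \<open>c\<close>. The induction hypothesis is used at both, hence its
      generality in \<open>c\<close>.\<close>
    define e where "e = sqrt ((1 + c) / 2)"
    have e2: "2 * e\<^sup>2 - 1 = c"
      using Suc.prems by (simp add: e_def field_simps)
    have e: "\<bar>e\<bar> \<le> 1" "\<bar>- e\<bar> \<le> 1"
      using Suc.prems by (auto simp: e_def real_sqrt_le_1_iff)
    have sq: "z ^ 2 ^ Suc m = z ^ 2 ^ m * z ^ 2 ^ m" for z :: 'a
      by (simp add: power_add[symmetric] mult_2)
    define Y where "Y = y ^ 2 ^ m"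
    define X where "X = x ^ 2 ^ m"
    note IH = Suc.IH[OF e(1), folded Y_def X_def] Suc.IH[OF e(2), folded Y_def X_def]
    have units: "two_sided_unit (poisson_denom c (Y * Y))" "two_sided_unit (poisson_denom c (X * X))"
      using IH poisson_denom_double[of e Y] poisson_denom_double[of e X]
      by (auto simp: e2 intro: two_sided_unit_mult)
    have kernels: "poisson_kernel c (Y * Y) = (1 / 2) *\<^sub>R (poisson_kernel e Y + poisson_kernel (- e) Y)"
      "poisson_kernel c (X * X) = (1 / 2) *\<^sub>R (poisson_kernel e X + poisson_kernel (- e) X)"
      using IH poisson_kernel_double[of e Y] poisson_kernel_double[of e X] by (simp_all add: e2)
    have "poisson_kernel c (Y * Y) - poisson_kernel c (X * X) =
      (1 / 2) *\<^sub>R ((poisson_kernel e Y - poisson_kernel e X) + (poisson_kernel (- e) Y - poisson_kernel (- e) X))"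
      by (simp add: kernels algebra_simps)
    also have "norm \<dots> \<le> (1 / 2) * (1 / 4 + 1 / 4)"
      unfolding norm_scaleR using IH by (intro mult_mono norm_triangle_mono) auto
    finally show ?case
      using units unfolding sq Y_def[symmetric] X_def[symmetric] by simp
  qed
  \<comment> \<open>At angle 0 the kernel is (1 + z)/(1 - z), which exceeds 1 by 2z/(1 - z); this is
    stated here with denominators cleared.\<close>
  have kernel_one: "(poisson_kernel 1 z - 1) * ((1 - z) * (1 - z)) = (2 *\<^sub>R z) * (1 - z)"
    if "two_sided_unit (poisson_denom 1 z)" for z :: 'a
  proof -
    have q: "poisson_denom 1 z = (1 - z) * (1 - z)"
      by (simp add: poisson_denom_def algebra_simps scaleR_2)
    have "(poisson_kernel 1 z - 1) * poisson_denom 1 z =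
      (1 - z * z) * (unit_inverse (poisson_denom 1 z) * poisson_denom 1 z) - poisson_denom 1 z"
      by (simp add: poisson_kernel_def left_diff_distrib mult.assoc)
    also have "\<dots> = (1 - z * z) - poisson_denom 1 z"
      by (simp add: unit_inverse(2)[OF that])
    also have "\<dots> = (2 *\<^sub>R z) * (1 - z)"
      by (simp add: poisson_denom_def algebra_simps scaleR_2)
    finally show ?thesis by (simp add: q)
  qed
  have "(\<lambda>n. r ^ n) \<longlonglongrightarrow> 0"
    using r by (intro LIMSEQ_power_zero) auto
  then have "eventually (\<lambda>n. r ^ n < 1 / 20) sequentially"
    by (rule order_tendstoD) simp
  then obtain m where "r ^ m < 1 / 20"
    by (auto simp: eventually_sequentially)
  moreover have "r ^ 2 ^ m \<le> r ^ m"
    using r by (intro power_decreasing) (auto intro: less_imp_le)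
  ultimately have rm: "r ^ 2 ^ m < 1 / 20" by simp
  define Y where "Y = y ^ 2 ^ m"
  define X where "X = x ^ 2 ^ m"
  have "norm Y \<le> norm y ^ 2 ^ m"
    unfolding Y_def by (rule norm_power_ineq)
  also have "\<dots> \<le> r ^ 2 ^ m"
    using r x mult_left_mono[OF x r(1)] by (intro power_mono) (auto simp: y_def)
  finally have Y: "norm Y \<le> 1 / 20" using rm by simp
  note cl = close[of 1 m, folded Y_def X_def, simplified]
  define D where "D = poisson_kernel 1 Y - 1"
  define E where "E = poisson_kernel 1 X - 1"
  have "D * ((1 - Y) * (1 - Y)) = (2 *\<^sub>R Y) * (1 - Y)"
    using kernel_one[of Y] cl by (simp add: D_def)
  \<comment> \<open>Every term on the right that contains \<open>D\<close> also contains
    \<open>Y\<close>; since \<open>norm Y \<le> 1 / 20\<close>, these terms are absorbed and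
    \<open>norm D \<le> 1 / 4\<close> remains.\<close>
  then have Deq: "D = 2 *\<^sub>R Y - 2 *\<^sub>R (Y * Y) + 2 *\<^sub>R (D * Y) - D * (Y * Y)"
    by (simp add: algebra_simps scaleR_2)
  have YY: "norm (Y * Y) \<le> 1 / 400"
    using order_trans[OF norm_mult_ineq mult_mono[OF Y Y]] by simp
  have DY: "norm (D * Y) \<le> norm D * (1 / 20)" "norm (D * (Y * Y)) \<le> norm D * (1 / 400)"
    using order_trans[OF norm_mult_ineq mult_left_mono[OF Y norm_ge_zero]]
      order_trans[OF norm_mult_ineq mult_left_mono[OF YY norm_ge_zero]] by auto
  have "norm D \<le> norm (2 *\<^sub>R Y) + norm (2 *\<^sub>R (Y * Y)) + norm (2 *\<^sub>R (D * Y)) + norm (D * (Y * Y))"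
    by (subst Deq) (intro norm_triangle_le norm_triangle_le_diff add_mono order_refl)
  then have "norm D \<le> 2 * norm Y + 2 * norm (Y * Y) + 2 * norm (D * Y) + norm (D * (Y * Y))"
    by simp
  then have D: "norm D \<le> 1 / 4"
    using Y YY DY by linarith
  have "norm E \<le> norm D + norm (D - E)"
    using norm_triangle_ineq4[of D "D - E"] by simp
  also have "\<dots> \<le> 1 / 2"
    using D cl by (simp add: D_def E_def)
  finally have E: "norm E \<le> 1 / 2" .
  have "two_sided_unit ((1 - X) * (1 - X))"
    using cl by (simp add: poisson_denom_def algebra_simps scaleR_2)
  then obtain g where g: "(1 - X) * g = 1"
    using two_sided_unit_factor[of "1 - X" "1 - X"] by (auto simp: two_sided_unit_def)
  \<comment> \<open>Cancelling one factor by its right inverse \<open>g\<close> leaves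
    \<open>E * (1 - X) = 2 *\<^sub>R X\<close>. As \<open>norm E \<le> 1 / 2\<close>, this forces
    \<open>norm X \<le> 1 / 3\<close>.\<close>
  have "(E * (1 - X)) * ((1 - X) * g) = (2 *\<^sub>R X) * ((1 - X) * g)"
    using arg_cong[OF kernel_one[of X], of "\<lambda>z. z * g"] cl by (simp add: E_def mult.assoc)
  then have "2 *\<^sub>R X = E - E * X"
    by (simp add: g right_diff_distrib)
  then have "2 * norm X \<le> norm E + norm (E * X)"
    using norm_triangle_ineq4[of E "E * X"] by (metis norm_scaleR abs_numeral)
  also have "\<dots> \<le> 1 / 2 + (1 / 2) * norm X"
    using E order_trans[OF norm_mult_ineq mult_right_mono[OF E norm_ge_zero]] by (intro add_mono) auto
  finally have "norm X < 1" by simp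
  then show thesis by (intro that) (simp add: X_def)
qed

section \<open>Selfadjoint and positive elements\<close>

context cstar_involution
begin

lemma norm_star: "norm (star x) = norm x"
proof -
  have *: "norm x \<le> norm (star x)" for x
  proof (cases "x = 0")
    case False
    have "norm x * norm x \<le> norm (star x) * norm x"
      using norm_mult_ineq[of "star x" x] by (simp add: cstar_identity power2_eq_square)
    then show ?thesis using False by simp
  qed simp
  show ?thesis using *[of x] *[of "star x"] by (simp add: star_star)
qed

lemma star_zero: "star 0 = 0"
  using norm_star[of 0] by simp

lemma star_minus: "star (- x) = - star x"
  using star_add[of x "- x"] by (simp add: star_zero eq_neg_iff_add_eq_0 add.commute)

lemma star_diff: "star (x - y) = star x - star y"
  using star_add[of x "- y"] by (simp add: star_minus)

lemma star_one: "star 1 = 1"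
  using star_mult[of "star 1" 1] by (simp add: star_star)

lemma norm_selfadjoint_square: "star h = h \<Longrightarrow> norm (h * h) = (norm h)\<^sup>2"
  using cstar_identity[of h] by simp

lemma star_power: "star (x ^ n) = star x ^ n"
  by (induction n) (simp_all add: star_one star_mult power_commutes)

lemma norm_selfadjoint_power:
  assumes "star h = h"
  shows "norm (h ^ 2 ^ m) = norm h ^ 2 ^ m"
proof (induction m)
  case (Suc m)
  have "norm (h ^ 2 ^ Suc m) = norm (h ^ 2 ^ m * h ^ 2 ^ m)"
    by (simp add: power_add[symmetric] mult_2)
  also have "\<dots> = (norm h ^ 2 ^ m)\<^sup>2"
    by (subst norm_selfadjoint_square) (simp_all add: star_power assms Suc.IH)
  finally show ?case by (simp add: power_mult[symmetric] mult.commute)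
qed simp

end

text \<open>The common ground of the real and complex cases: selfadjoint elements have real
  spectrum. Order theory can thus be developed before \<open>star x * x\<close> is known to be
  positive in the complex case.\<close>

locale selfadjoint_real_spectrum = cstar_involution star
  for star :: "'a::{real_normed_algebra_1,banach} \<Rightarrow> 'a" +
  assumes star_scaleR: "star (r *\<^sub>R x) = r *\<^sub>R star x"
    and unit_one_plus_square: "star h = h \<Longrightarrow> two_sided_unit (1 + h * h)"
begin

lemma unit_square_plus:
  assumes "star h = h" "t > 0"
  shows "two_sided_unit (h * h + t *\<^sub>R 1)"
proof -
  have "two_sided_unit (1 + ((1 / sqrt t) *\<^sub>R h) * ((1 / sqrt t) *\<^sub>R h))"
    using assms by (intro unit_one_plus_square) (simp add: star_scaleR)
  moreover have "h * h + t *\<^sub>R 1 = t *\<^sub>R (1 + ((1 / sqrt t) *\<^sub>R h) * ((1 / sqrt t) *\<^sub>R h))"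
    using assms by (simp add: algebra_simps flip: real_sqrt_mult)
  ultimately show ?thesis
    using assms by (simp add: two_sided_unit_scaleR_iff)
qed

text \<open>The norm of a selfadjoint element is at most its spectral radius. Otherwise
  \<open>h\<close> scaled to norm 1 has spectral radius below 1, so some repeated square has norm
  below 1; but the C*-identity keeps all these norms equal to 1.\<close>

lemma norm_selfadjoint_le:
  assumes h: "star h = h" and M: "M > 0" and unit: "\<And>t. \<bar>t\<bar> > M \<Longrightarrow> two_sided_unit (t *\<^sub>R 1 - h)"
  shows "norm h \<le> M"
proof (rule ccontr)
  assume "\<not> norm h \<le> M"
  then have N: "norm h > M" by simp
  then have h0: "h \<noteq> 0" using M by auto
  define x where "x = (1 / norm h) *\<^sub>R h"
  have hx: "star x = x" by (simp add: x_def star_scaleR h)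
  have nx: "norm x = 1" using N M by (auto simp: x_def)
  have lin: "two_sided_unit (1 - r *\<^sub>R x)" if "\<bar>r\<bar> \<le> 1" for r
  proof (cases "r = 0")
    case True
    then show ?thesis by (simp add: two_sided_unitI[of 1 1])
  next
    case False
    define t where "t = norm h / r"
    have "\<bar>t\<bar> \<ge> norm h"
      using that False by (simp add: t_def abs_divide le_divide_eq mult_left_le)
    then have "two_sided_unit (t *\<^sub>R 1 - h)" using N by (intro unit) simp
    moreover have "1 - r *\<^sub>R x = (1 / t) *\<^sub>R (t *\<^sub>R 1 - h)"
      using False h0 by (simp add: t_def x_def scaleR_diff_right)
    ultimately show ?thesis
      using False h0 by (simp add: two_sided_unit_scaleR_iff t_def)
  qed
  have "two_sided_unit (poisson_denom c (r *\<^sub>R x))" if "\<bar>c\<bar> \<le> 1" "0 \<le> r" "r \<le> 1" for c r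
  \<comment> \<open>For \<open>c\<close> = 1 or -1 the denominator is the square of
    \<open>1 - (c * r) *\<^sub>R x\<close>. Otherwise it is the square of
    \<open>r *\<^sub>R x - c *\<^sub>R 1\<close> plus the positive scalar
    \<open>1 - c * c\<close>.\<close>
  proof (cases "\<bar>c\<bar> = 1")
    case True
    then have "poisson_denom c (r *\<^sub>R x) = (1 - (c * r) *\<^sub>R x) * (1 - (c * r) *\<^sub>R x)"
      by (auto simp: poisson_denom_def algebra_simps scaleR_2 abs_if simp flip: scaleR_add_left split: if_splits)
    moreover have "\<bar>c * r\<bar> \<le> 1" using True that by (simp add: abs_mult)
    ultimately show ?thesis using lin by (simp add: two_sided_unit_mult)
  next
    case False
    then have c: "1 - c * c > 0"
      using that abs_square_less_1[of c] by (simp add: power2_eq_square)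
    define z where "z = r *\<^sub>R x - c *\<^sub>R 1"
    have "star z = z" by (simp add: z_def star_diff star_scaleR star_one hx)
    then have "two_sided_unit (z * z + (1 - c * c) *\<^sub>R 1)"
      using c by (rule unit_square_plus)
    moreover have "z * z + (1 - c * c) *\<^sub>R 1 = poisson_denom c (r *\<^sub>R x)"
      by (simp add: z_def poisson_denom_def algebra_simps flip: scaleR_add_left)
    ultimately show ?thesis by simp
  qed
  then obtain m where "norm (x ^ 2 ^ m) < 1"
    using norm_power_two_power_less_one[of x] nx by auto
  then show False
    by (simp add: norm_selfadjoint_power[OF hx] nx)
qed

text \<open>Only negative real spectral points are excluded, because a selfadjoint element has no
  others off the half line. This makes the notion independent of the scalar field.\<close>

definition pos :: "'a \<Rightarrow> bool" where
  "pos h \<longleftrightarrow> star h = h \<and> (\<forall>t>0. two_sided_unit (t *\<^sub>R 1 + h))"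

lemma posD: "pos h \<Longrightarrow> star h = h" "pos h \<Longrightarrow> t > 0 \<Longrightarrow> two_sided_unit (t *\<^sub>R 1 + h)"
  by (auto simp: pos_def)

text \<open>The spectrum of \<open>h\<close> lies in [0,R], hence so does that of
  \<open>R *\<^sub>R 1 - h\<close>. Together with the converse \<open>posI_norm\<close> this
  describes positivity by a norm inequality, so that sums of positive elements are handled by the
  triangle inequality.\<close>

lemma pos_norm:
  assumes h: "pos h" and R: "norm h \<le> R"
  shows "norm (R *\<^sub>R 1 - h) \<le> R"
proof (cases "R = 0")
  case True
  then show ?thesis using R by simp
next
  case False
  then have "R > 0" using R norm_ge_zero[of h] by linarith
  show ?thesis
  proof (rule norm_selfadjoint_le[OF _ \<open>R > 0\<close>])
    show "star (R *\<^sub>R 1 - h) = R *\<^sub>R 1 - h"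
      by (simp add: star_diff star_scaleR star_one posD(1)[OF h])
    fix t :: real assume t: "\<bar>t\<bar> > R"
    show "two_sided_unit (t *\<^sub>R 1 - (R *\<^sub>R 1 - h))"
    proof (cases "t > 0")
      case True
      then show ?thesis
        using posD(2)[OF h, of "t - R"] t by (simp add: algebra_simps)
    next
      case False
      then have "two_sided_unit (- ((R - t) *\<^sub>R 1 - h))"
        using t R \<open>R > 0\<close> two_sided_unit_scaleR_one_minus[of h "R - t"]
        by (simp only: two_sided_unit_minus_iff)
      then show ?thesis by (simp add: algebra_simps)
    qed
  qed
qed

lemma posI_norm:
  assumes "star h = h" and "norm (R *\<^sub>R 1 - h) \<le> R"
  shows "pos h"
  unfolding pos_def
proof (intro conjI allI impI)
  fix t :: real assume "t > 0"
  then have "two_sided_unit ((t + R) *\<^sub>R 1 - (R *\<^sub>R 1 - h))"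
    using assms by (intro two_sided_unit_scaleR_one_minus) simp
  then show "two_sided_unit (t *\<^sub>R 1 + h)" by (simp add: algebra_simps)
qed fact

lemma pos_add:
  assumes h: "pos h" and k: "pos k"
  shows "pos (h + k)"
proof (rule posI_norm)
  show "star (h + k) = h + k" by (simp add: star_add posD(1) h k)
  have "norm ((norm h *\<^sub>R 1 - h) + (norm k *\<^sub>R 1 - k)) \<le> norm h + norm k"
    by (intro norm_triangle_mono pos_norm h k order_refl)
  then show "norm ((norm h + norm k) *\<^sub>R 1 - (h + k)) \<le> norm h + norm k"
    by (simp add: algebra_simps)
qed

lemma pos_scaleR:
  assumes h: "pos h" and c: "c > 0"
  shows "pos (c *\<^sub>R h)"
  unfolding pos_def
proof (intro conjI allI impI)
  show "star (c *\<^sub>R h) = c *\<^sub>R h" by (simp add: star_scaleR posD(1)[OF h])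
  fix t :: real assume "t > 0"
  then have "two_sided_unit (c *\<^sub>R ((t / c) *\<^sub>R 1 + h))"
    using c posD(2)[OF h, of "t / c"] by (simp add: two_sided_unit_scaleR_iff)
  then show "two_sided_unit (t *\<^sub>R 1 + c *\<^sub>R h)"
    using c by (simp add: scaleR_add_right)
qed

lemma pos_square: "star h = h \<Longrightarrow> pos (h * h)"
  using unit_square_plus[of h] by (simp add: pos_def star_mult add.commute)

text \<open>Since \<open>t *\<^sub>R 1 - p\<close> is \<open>(t + 1) *\<^sub>R 1 - (1 + p)\<close>,
  a smaller norm of \<open>1 + p\<close> would push the spectral radius of \<open>p\<close> below
  its norm.\<close>

lemma norm_one_plus_pos:
  assumes p: "pos p"
  shows "norm (1 + p) = 1 + norm p"
proof (rule antisym)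
  show "norm (1 + p) \<le> 1 + norm p"
    using norm_triangle_ineq[of 1 p] by simp
  show "1 + norm p \<le> norm (1 + p)"
  proof (rule ccontr)
    assume "\<not> 1 + norm p \<le> norm (1 + p)"
    then have lt: "norm (1 + p) - 1 < norm p" by simp
    then have "norm p > 0" by auto
    \<comment> \<open>The second entry only keeps \<open>M\<close> positive, as the spectral radius
      bound requires.\<close>
    define M where "M = max (norm (1 + p) - 1) (norm p / 2)"
    have M: "M > 0" "M < norm p"
      using lt \<open>norm p > 0\<close> by (auto simp: M_def less_max_iff_disj)
    have "norm p \<le> M"
    proof (rule norm_selfadjoint_le[OF posD(1)[OF p] M(1)])
      fix t assume t: "\<bar>t\<bar> > M"
      show "two_sided_unit (t *\<^sub>R 1 - p)"
      proof (cases "t > 0")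
        case True
        then have "two_sided_unit ((t + 1) *\<^sub>R 1 - (1 + p))"
          using t by (intro two_sided_unit_scaleR_one_minus) (auto simp: M_def)
        then show ?thesis by (simp add: algebra_simps)
      next
        case False
        then have "two_sided_unit (- ((- t) *\<^sub>R 1 + p))"
          using t M posD(2)[OF p, of "- t"] by (simp only: two_sided_unit_minus_iff)
        then show ?thesis by simp
      qed
    qed
    then show False using M by simp
  qed
qed

text \<open>Off the real line a selfadjoint square plus a positive scalar is a unit. At a real point
  the element defining the spectrum is the square of \<open>h\<close> minus that scalar.\<close>

lemma real_positive_iff: "real_positive star h \<longleftrightarrow> pos h"
proof
  assume h: "real_positive star h"
  show "pos h"
    unfolding pos_def
  proof (intro conjI allI impI)
    show "star h = h" using h by (simp add: real_positive_def)
    fix t :: real assume "t > 0"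
    then have "complex_of_real (- t) \<notin> real_spectrum h"
      using h by (auto simp: real_positive_def complex_nonneg_Reals_iff dest!: subsetD)
    then have "two_sided_unit ((t *\<^sub>R 1 + h) * (t *\<^sub>R 1 + h))"
      by (simp add: real_spectrum_def of_real_def power2_eq_square algebra_simps)
    then show "two_sided_unit (t *\<^sub>R 1 + h)" by (rule two_sided_unit_factor) simp
  qed
next
  assume h: "pos h"
  show "real_positive star h"
    unfolding real_positive_def
  proof (intro conjI subsetI)
    show sa: "star h = h" by (rule posD(1)[OF h])
    fix z assume z: "z \<in> real_spectrum h"
    define k where "k = h - Re z *\<^sub>R 1"
    have k: "star k = k" by (simp add: k_def star_diff star_scaleR star_one sa)
    have nu: "\<not> two_sided_unit (k * k + (Im z)\<^sup>2 *\<^sub>R 1)"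
      using z by (simp add: real_spectrum_def of_real_def k_def power2_eq_square)
    then have "Im z = 0" using unit_square_plus[OF k, of "(Im z)\<^sup>2"] by auto
    moreover have "Re z \<ge> 0"
    proof (rule ccontr)
      assume "\<not> Re z \<ge> 0"
      then have "two_sided_unit k"
        using posD(2)[OF h, of "- Re z"] by (simp add: k_def add.commute)
      then show False using nu \<open>Im z = 0\<close> by (simp add: two_sided_unit_mult)
    qed
    ultimately show "z \<in> \<real>\<^sub>\<ge>\<^sub>0" by (simp add: complex_nonneg_Reals_iff)
  qed
qed

end

section \<open>States and contractive functionals\<close>

context selfadjoint_real_spectrum
begin

lemma pos_norm_minus:
  assumes "star h = h"
  shows "pos (norm h *\<^sub>R 1 - h)"
  by (rule posI_norm[of _ "norm h"]) (simp_all add: star_diff star_scaleR star_one assms)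

text \<open>Invariance under \<open>star\<close> reduces the bound to the selfadjoint part
  \<open>h\<close> of \<open>x\<close>, where positivity of \<open>norm h *\<^sub>R 1 - h\<close>
  gives it.\<close>

lemma real_state_le_norm:
  assumes f: "real_state star f"
  shows "f x \<le> norm x"
proof -
  define h where "h = (1 / 2) *\<^sub>R (x + star x)"
  have lin: "linear f" using f by (simp add: real_state_def)
  have h: "star h = h"
    by (simp add: h_def star_scaleR star_add star_star add.commute)
  have "0 \<le> f (norm h *\<^sub>R 1 - h)"
    using f pos_norm_minus[OF h] by (simp add: real_state_def real_positive_iff)
  also have "\<dots> = norm h - f h"
    using f by (simp add: linear_diff[OF lin] linear_scale[OF lin] real_state_def)
  finally have "f h \<le> norm h" by simp
  also have "\<dots> \<le> norm x"
    using norm_triangle_ineq[of x "star x"] by (simp add: h_def norm_star)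
  also have "f h = f x"
    using f by (simp add: h_def linear_add[OF lin] linear_scale[OF lin] real_state_def)
  finally show ?thesis .
qed

text \<open>Positivity follows from contractivity: for positive \<open>h\<close> the norm of
  \<open>norm h *\<^sub>R 1 - h\<close> is at most \<open>norm h\<close>, so
  \<open>norm h - f h \<le> norm h\<close>.\<close>

lemma real_stateI:
  assumes f: "linear f" and le: "\<And>x. \<bar>f x\<bar> \<le> norm x" and one: "f 1 = 1"
    and star: "\<And>x. f (star x) = f x"
  shows "real_state star f"
proof -
  have "f h \<ge> 0" if h: "pos h" for h
  proof -
    have "norm h - f h = f (norm h *\<^sub>R 1 - h)"
      by (simp add: linear_diff[OF f] linear_scale[OF f] one)
    also have "\<dots> \<le> norm h"
      using le[of "norm h *\<^sub>R 1 - h"] pos_norm[OF h order_refl] by linarith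
    finally show ?thesis by simp
  qed
  then show ?thesis
    using f one star by (simp add: real_state_def real_positive_iff)
qed

end

section \<open>Real C*-algebras\<close>

lemma best_approximation_iff:
  assumes "b \<in> B"
  shows "best_approximation a B b \<longleftrightarrow> (\<forall>x\<in>B. norm (a - b) \<le> norm (a - x))"
proof
  assume "best_approximation a B b"
  then show "\<forall>x\<in>B. norm (a - b) \<le> norm (a - x)"
    using infdist_le[of _ B a] by (auto simp: best_approximation_def dist_norm)
next
  assume *: "\<forall>x\<in>B. norm (a - b) \<le> norm (a - x)"
  \<comment> \<open>The library sets \<open>infdist\<close> to 0 on the empty set, so the
    description as an infimum needs a member of \<open>B\<close>.\<close>
  have "B \<noteq> {}" using assms by auto
  then have "norm (a - b) \<le> infdist a B"
    using * by (auto simp: infdist_notempty dist_norm intro!: cINF_greatest)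
  moreover have "infdist a B \<le> norm (a - b)"
    using infdist_le[OF assms, of a] by (simp add: dist_norm)
  ultimately show "best_approximation a B b"
    using assms by (simp add: best_approximation_def)
qed

sublocale unital_real_cstar_algebra \<subseteq> selfadjoint_real_spectrum star
proof
  show "star (r *\<^sub>R x) = r *\<^sub>R star x" for r x by (rule star_scaleR)
  show "two_sided_unit (1 + h * h)" if "star h = h" for h
    using unit_one_plus[of h] that by simp
qed

context unital_real_cstar_algebra
begin

lemma pos_star_mult_self: "pos (star x * x)"
  unfolding pos_def
proof (intro conjI allI impI)
  show "star (star x * x) = star x * x" by (simp add: star_mult star_star)
  fix t :: real assume t: "t > 0"
  define y where "y = (1 / sqrt t) *\<^sub>R x"
  have "t *\<^sub>R 1 + star x * x = t *\<^sub>R (1 + star y * y)"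
    using t by (simp add: y_def star_scaleR algebra_simps flip: real_sqrt_mult)
  then show "two_sided_unit (t *\<^sub>R 1 + star x * x)"
    using t unit_one_plus[of y] by (simp add: two_sided_unit_scaleR_iff)
qed

lemma norm_one_plus_star_mult_self: "norm (1 + star x * x) = 1 + (norm x)\<^sup>2"
  using norm_one_plus_pos[OF pos_star_mult_self[of x]] by (simp add: cstar_identity)

text \<open>
  The norm of \<open>1 + (u + t b)\<^sup>*(u + t b)\<close> is at least that of \<open>1 + u\<^sup>*u\<close>, so
  \<open>s \<mapsto> norm (1 + u\<^sup>*u + s w)\<close> drops by at most \<open>O(s\<^sup>2)\<close>; being convex it does not drop at all.
\<close>
lemma norm_one_plus_star_mult_self_le:
  assumes "\<And>t. norm u \<le> norm (u + t *\<^sub>R b)"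
  defines "v \<equiv> 1 + star u * u" and "w \<equiv> star u * b + star b * u"
  shows "norm v \<le> norm (v + w)"
proof (rule field_le_epsilon)
  fix e :: real assume e: "e > 0"
  \<comment> \<open>With \<open>t \<le> 1\<close> the weights below are convex, and the second entry
    keeps \<open>t * (norm b)\<^sup>2\<close> below \<open>e\<close>; the added 1 avoids division by
    zero.\<close>
  define t where "t = min 1 (e / (1 + (norm b)\<^sup>2))"
  have b: "1 + (norm b)\<^sup>2 > 0" by (simp add: add_pos_nonneg)
  have t: "0 < t" "t \<le> 1" using e b by (auto simp: t_def)
  have "t * (norm b)\<^sup>2 \<le> t * (1 + (norm b)\<^sup>2)"
    using t by (intro mult_left_mono) auto
  also have "\<dots> \<le> e"
    using b by (simp add: t_def flip: pos_le_divide_eq)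
  finally have te: "t * (norm b)\<^sup>2 \<le> e" .
  have "norm v = 1 + (norm u)\<^sup>2"
    by (simp add: v_def norm_one_plus_star_mult_self)
  also have "\<dots> \<le> 1 + (norm (u + t *\<^sub>R b))\<^sup>2"
    using assms(1) by (intro add_left_mono power_mono) auto
  also have "\<dots> = norm (1 + star (u + t *\<^sub>R b) * (u + t *\<^sub>R b))"
    by (simp only: norm_one_plus_star_mult_self)
  \<comment> \<open>The first-order part \<open>v + t *\<^sub>R w\<close> is written as a convex
    combination of \<open>v\<close> and \<open>v + w\<close>.\<close>
  also have "1 + star (u + t *\<^sub>R b) * (u + t *\<^sub>R b) =
      ((1 - t) *\<^sub>R v + t *\<^sub>R (v + w)) + t\<^sup>2 *\<^sub>R (star b * b)"
    by (simp add: v_def w_def star_add star_scaleR algebra_simps power2_eq_square)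
  also have "norm \<dots> \<le> ((1 - t) * norm v + t * norm (v + w)) + t\<^sup>2 * (norm b)\<^sup>2"
    using t by (intro norm_triangle_mono) (simp_all add: cstar_identity)
  finally have "t * norm v \<le> t * (norm (v + w) + t * (norm b)\<^sup>2)"
    by (simp add: algebra_simps power2_eq_square)
  then have "norm v \<le> norm (v + w) + t * (norm b)\<^sup>2"
    using t by simp
  then show "norm v \<le> norm (v + w) + e" using te by simp
qed

lemma state_orthogonal_to_subspace:
  assumes B: "subspace B" and u: "\<And>b. b \<in> B \<Longrightarrow> norm u \<le> norm (u + b)"
  obtains f where "real_state star f" and "f (star u * u) = (norm u)\<^sup>2"
    and "\<And>b. b \<in> B \<Longrightarrow> f (star u * b) = 0"
proof -
  define v where "v = 1 + star u * u"
  define W where "W = (\<lambda>b. star u * b + star b * u) ` B"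
  have "linear (\<lambda>b. star u * b + star b * u)"
    by (rule linearI) (simp_all add: star_add star_scaleR algebra_simps)
  then have W: "subspace W"
    unfolding W_def using B by (rule linear_subspace_image)
  have "norm v \<le> norm (v + w)" if "w \<in> W" for w
    using that norm_one_plus_star_mult_self_le[of u] u subspace_scale[OF B]
    by (auto simp: W_def v_def)
  then obtain g where g: "linear g" and g_le: "\<And>x. \<bar>g x\<bar> \<le> norm x"
    and gv: "g v = norm v" and gW: "\<And>w. w \<in> W \<Longrightarrow> g w = 0"
    using norming_functional_vanishing_on_subspace[OF W] by metis
  have "g v = g 1 + g (star u * u)"
    by (simp add: v_def linear_add[OF g])
  \<comment> \<open>The two values are at most 1 and \<open>(norm u)\<^sup>2\<close>, while their
    sum is \<open>1 + (norm u)\<^sup>2\<close>; so both bounds are attained.\<close>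
  then have g1: "g 1 = 1" and gu: "g (star u * u) = (norm u)\<^sup>2"
    using gv g_le[of 1] g_le[of "star u * u"]
    by (simp_all add: v_def norm_one_plus_star_mult_self cstar_identity abs_le_iff)
  define f where "f = (\<lambda>x. (g x + g (star x)) / 2)"
  show thesis
  proof
    show "real_state star f"
    proof (rule real_stateI)
      show "linear f"
        by (rule linearI)
          (simp_all add: f_def star_add star_scaleR linear_add[OF g] linear_scale[OF g] field_simps)
      show "\<bar>f x\<bar> \<le> norm x" for x
        using g_le[of x] g_le[of "star x"] by (auto simp: f_def norm_star)
      show "f 1 = 1" by (simp add: f_def star_one g1)
      show "f (star x) = f x" for x by (simp add: f_def star_star)
    qed
    show "f (star u * u) = (norm u)\<^sup>2"
      by (simp add: f_def star_mult star_star gu)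
    \<comment> \<open>Twice this value is \<open>g\<close> at
      \<open>star u * b + star b * u\<close>, an element of \<open>W\<close>.\<close>
    show "f (star u * b) = 0" if "b \<in> B" for b
      using gW[of "star u * b + star b * u"] that
      by (auto simp: f_def W_def star_mult star_star linear_add[OF g])
  qed
qed

lemma best_approximation_iff_real_state:
  assumes B: "subspace B" and b0: "b\<^sub>0 \<in> B"
  shows "best_approximation a B b\<^sub>0 \<longleftrightarrow>
    (\<exists>\<phi>. real_state star \<phi> \<and> \<phi> (star (a - b\<^sub>0) * (a - b\<^sub>0)) = (norm (a - b\<^sub>0))\<^sup>2 \<and>
      (\<forall>b\<in>B. \<phi> (star a * b) = \<phi> (star b\<^sub>0 * b)))"
  unfolding best_approximation_iff[OF b0]
proof
  assume best: "\<forall>x\<in>B. norm (a - b\<^sub>0) \<le> norm (a - x)"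
  have "norm (a - b\<^sub>0) \<le> norm ((a - b\<^sub>0) + b)" if "b \<in> B" for b
    using best subspace_diff[OF B b0 that] by (force simp: algebra_simps)
  then obtain f where f: "real_state star f" "f (star (a - b\<^sub>0) * (a - b\<^sub>0)) = (norm (a - b\<^sub>0))\<^sup>2"
    and 0: "\<And>b. b \<in> B \<Longrightarrow> f (star (a - b\<^sub>0) * b) = 0"
    using state_orthogonal_to_subspace[OF B, of "a - b\<^sub>0"] by metis
  have "linear f" using f by (simp add: real_state_def)
  then have "f (star a * b) = f (star b\<^sub>0 * b)" if "b \<in> B" for b
    using 0[OF that] by (simp add: star_diff left_diff_distrib linear_diff)
  then show "\<exists>\<phi>. real_state star \<phi> \<and> \<phi> (star (a - b\<^sub>0) * (a - b\<^sub>0)) = (norm (a - b\<^sub>0))\<^sup>2 \<and>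
      (\<forall>b\<in>B. \<phi> (star a * b) = \<phi> (star b\<^sub>0 * b))"
    using f by blast
next
  assume "\<exists>\<phi>. real_state star \<phi> \<and> \<phi> (star (a - b\<^sub>0) * (a - b\<^sub>0)) = (norm (a - b\<^sub>0))\<^sup>2 \<and>
      (\<forall>b\<in>B. \<phi> (star a * b) = \<phi> (star b\<^sub>0 * b))"
  then obtain f where f: "real_state star f" "f (star (a - b\<^sub>0) * (a - b\<^sub>0)) = (norm (a - b\<^sub>0))\<^sup>2"
    and eq: "\<And>b. b \<in> B \<Longrightarrow> f (star a * b) = f (star b\<^sub>0 * b)"
    by blast
  have lin: "linear f" using f by (simp add: real_state_def)
  show "\<forall>x\<in>B. norm (a - b\<^sub>0) \<le> norm (a - x)"
  proof
    fix x assume x: "x \<in> B"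
    define u where "u = a - b\<^sub>0"
    have "star u * (a - x) = star u * u - (star a * (x - b\<^sub>0) - star b\<^sub>0 * (x - b\<^sub>0))"
      by (simp add: u_def star_diff algebra_simps)
    then have "f (star u * (a - x)) = (norm u)\<^sup>2"
      using f(2) eq[OF subspace_diff[OF B x b0]] by (simp add: linear_diff[OF lin] u_def)
    then have "(norm u)\<^sup>2 \<le> norm (star u * (a - x))"
      using real_state_le_norm[OF f(1), of "star u * (a - x)"] by simp
    also have "\<dots> \<le> norm u * norm (a - x)"
      using norm_mult_ineq[of "star u" "a - x"] by (simp add: norm_star)
    finally show "norm (a - b\<^sub>0) \<le> norm (a - x)"
      by (cases "norm u = 0") (auto simp: u_def power2_eq_square)
  qed
qed

end

section \<open>Complex C*-algebras\<close>

text \<open>For p(t) = t (t - c)^2 this factors p(h) - p(r) by h - r. The left side has p(h) in the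
  shape in which it arises as some \<open>star y * y\<close>; the second equation gives the
  commutation needed to infer that a factor is a unit.\<close>

lemma cubic_factor:
  fixes h :: "'a::real_algebra_1"
  shows "(c *\<^sub>R 1 - h) * h * (c *\<^sub>R 1 - h) - (r * (r - c)\<^sup>2) *\<^sub>R 1 =
    (h - r *\<^sub>R 1) * (h * h + (r - 2 * c) *\<^sub>R h + (r - c)\<^sup>2 *\<^sub>R 1)"
    and "(h - r *\<^sub>R 1) * (h * h + (r - 2 * c) *\<^sub>R h + (r - c)\<^sup>2 *\<^sub>R 1) =
    (h * h + (r - 2 * c) *\<^sub>R h + (r - c)\<^sup>2 *\<^sub>R 1) * (h - r *\<^sub>R 1)"
  by (simp_all add: algebra_simps power2_eq_square)
    (simp add: algebra_simps flip: scaleR_add_left)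

section \<open>Real spectrum of selfadjoint elements over the complex scalars\<close>

context unital_complex_cstar_algebra
begin

lemma star_scaleR: "star (r *\<^sub>R x) = r *\<^sub>R star x"
  using star_scaleC[of "complex_of_real r" x] by (simp add: scaleC_of_real)

lemma scaleC_scaleR: "scaleC c (r *\<^sub>R x) = r *\<^sub>R scaleC c x"
  by (simp add: mult.commute flip: scaleC_of_real)

lemma scaleC_ii_ii: "scaleC \<i> (scaleC \<i> x) = - x"
  using scaleC_of_real[of "-1" x] by simp

lemma two_sided_unit_scaleC:
  assumes "two_sided_unit x" "c \<noteq> 0"
  shows "two_sided_unit (scaleC c x)"
proof -
  obtain y where "x * y = 1" "y * x = 1"
    using assms by (auto simp: two_sided_unit_def)
  then show ?thesis
    using assms by (intro two_sided_unitI[of _ "scaleC (1 / c) y"])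
      (simp_all add: scaleC_mult_left scaleC_mult_right)
qed

lemma two_sided_unit_scaleC_one_minus:
  assumes "norm x < cmod c"
  shows "two_sided_unit (scaleC c 1 - x)"
proof -
  have c: "c \<noteq> 0" using assms norm_ge_zero[of x] by force
  have "norm (scaleC (1 / c) x) < 1"
    using assms c by (simp add: norm_scaleC norm_divide field_simps)
  then have "two_sided_unit (scaleC c (1 - scaleC (1 / c) x))"
    using c by (intro two_sided_unit_scaleC two_sided_unit_one_minus)
  then show ?thesis using c by (simp add: scale_right_diff_distrib)
qed

text \<open>
  Subtracting \<open>\<i> t\<close> moves \<open>-\<i>\<close> to \<open>-\<i> (1 + t)\<close>, which for large \<open>t\<close> lies outside the spectrum of
  \<open>h - \<i> t\<close> because \<open>norm (h - \<i> t)\<^sup>2 \<le> (norm h)\<^sup>2 + t\<^sup>2 < (1 + t)\<^sup>2\<close>.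
\<close>
lemma two_sided_unit_selfadjoint_plus_ii:
  assumes h: "star h = h"
  shows "two_sided_unit (h + scaleC \<i> 1)"
proof -
  \<comment> \<open>The comparison of \<open>(norm h)\<^sup>2 + t\<^sup>2\<close> with
    \<open>(1 + t)\<^sup>2\<close> needs \<open>(norm h)\<^sup>2 < 1 + 2 * t\<close>, which this
    choice ensures.\<close>
  define t where "t = (norm h)\<^sup>2"
  define x where "x = h - t *\<^sub>R scaleC \<i> 1"
  have "star x = h + t *\<^sub>R scaleC \<i> 1"
    by (simp add: x_def star_diff h star_scaleR star_scaleC star_one scale_minus_left)
  then have "star x * x = h * h + t\<^sup>2 *\<^sub>R 1"
    by (simp add: x_def algebra_simps scaleC_mult_left scaleC_mult_right scaleC_scaleR scaleC_ii_ii
        power2_eq_square)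
  then have "(norm x)\<^sup>2 = norm (h * h + t\<^sup>2 *\<^sub>R 1)"
    by (simp flip: cstar_identity)
  also have "\<dots> \<le> t + t\<^sup>2"
    using norm_triangle_ineq[of "h * h" "t\<^sup>2 *\<^sub>R 1"] by (simp add: norm_selfadjoint_square[OF h] t_def)
  also have "\<dots> < (1 + t)\<^sup>2"
    by (simp add: power2_eq_square algebra_simps t_def add_pos_nonneg)
  finally have "norm (- x) < 1 + t"
    using power2_less_imp_less[of "norm x" "1 + t"] by (simp add: t_def)
  then have "norm (- x) < cmod (complex_of_real (1 + t) * \<i>)"
    unfolding norm_mult norm_of_real by (simp add: t_def)
  then have "two_sided_unit (scaleC (complex_of_real (1 + t) * \<i>) 1 - (- x))"
    by (rule two_sided_unit_scaleC_one_minus)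
  moreover have "scaleC (complex_of_real (1 + t) * \<i>) 1 = (1 + t) *\<^sub>R scaleC \<i> 1"
    by (simp only: scaleC_of_real flip: scale_scale)
  ultimately show ?thesis by (simp add: x_def algebra_simps)
qed

end

sublocale unital_complex_cstar_algebra \<subseteq> selfadjoint_real_spectrum star
proof
  show "star (r *\<^sub>R x) = r *\<^sub>R star x" for r x by (rule star_scaleR)
  show "two_sided_unit (1 + h * h)" if h: "star h = h" for h
  proof -
    have "two_sided_unit (- (- h + scaleC \<i> 1))"
      unfolding two_sided_unit_minus_iff
      by (intro two_sided_unit_selfadjoint_plus_ii) (simp add: star_minus h)
    then have "two_sided_unit ((h + scaleC \<i> 1) * (h - scaleC \<i> 1))"
      using two_sided_unit_selfadjoint_plus_ii[OF h] by (intro two_sided_unit_mult) simp_all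
    moreover have "(h + scaleC \<i> 1) * (h - scaleC \<i> 1) = 1 + h * h"
      by (simp add: algebra_simps scaleC_mult_left scaleC_mult_right scaleC_ii_ii)
    ultimately show ?thesis by simp
  qed
qed

section \<open>Positivity of \<open>star x * x\<close> over the complex scalars\<close>

context unital_complex_cstar_algebra
begin

text \<open>Up to sign, \<open>s\<close> and \<open>d\<close> are twice the real and imaginary parts
  of \<open>x\<close>; half the sum of their squares is the given element.\<close>

lemma pos_star_mult_self_plus: "pos (star x * x + x * star x)"
proof -
  define s where "s = x + star x"
  define d where "d = scaleC \<i> (x - star x)"
  have "star s = s"
    by (simp add: s_def star_add star_star add.commute)
  moreover have "star d = d"
    by (simp add: d_def star_scaleC star_diff star_star scale_minus_left flip: scale_minus_right)
  ultimately have "pos ((1 / 2) *\<^sub>R (s * s + d * d))"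
    by (intro pos_scaleR pos_add pos_square) auto
  moreover have "d * d = - ((x - star x) * (x - star x))"
    by (simp add: d_def scaleC_mult_left scaleC_mult_right scaleC_ii_ii)
  then have "s * s + d * d = 2 *\<^sub>R (star x * x + x * star x)"
    by (simp add: s_def algebra_simps scaleR_2)
  ultimately show ?thesis by simp
qed

text \<open>
  The constant 9 comes from \<open>y = x (c - h)\<close> with \<open>h = x\<^sup>*x\<close> and \<open>c = 3M/4\<close>: then \<open>y\<^sup>*y = p(h)\<close> for
  \<open>p(t) = t (t - c)\<^sup>2\<close>, whose maximum over \<open>t \<le> M\<close> is \<open>p(M) = M\<^sup>3/16\<close>, while \<open>- p(-s) \<ge> 9 s M\<^sup>2/16\<close>.
  So any bound on the ratio of the negative to the positive part of the spectrum, valid for all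
  elements of the form \<open>x\<^sup>*x\<close>, improves by the factor 9.
\<close>
lemma two_sided_unit_plus_star_mult_self_gt:
  assumes "M > 0" and "\<And>t. t > M \<Longrightarrow> two_sided_unit (t *\<^sub>R 1 - star x * x)"
    and "s > M / 9 ^ n"
  shows "two_sided_unit (s *\<^sub>R 1 + star x * x)"
  using assms
proof (induction n arbitrary: x M s)
  case 0
  \<comment> \<open>Swapping factors transfers the upper bound \<open>M\<close> from
    \<open>star x * x\<close> to \<open>x * star x\<close>. Hence
    \<open>star x * x + M *\<^sub>R 1\<close> is a sum of two positive elements.\<close>
  have "pos (M *\<^sub>R 1 - x * star x)"
    unfolding pos_def
  proof (intro conjI allI impI)
    show "star (M *\<^sub>R 1 - x * star x) = M *\<^sub>R 1 - x * star x"
      by (simp add: star_diff star_scaleR star_one star_mult star_star)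
    fix t :: real assume t: "t > 0"
    define r where "r = t + M"
    have r: "r > M" "r > 0" using t 0 by (auto simp: r_def)
    have "two_sided_unit (r *\<^sub>R (1 - ((1 / r) *\<^sub>R star x) * x))"
      using 0(2)[OF r(1)] r by (simp add: scaleR_diff_right)
    then have "two_sided_unit (1 - x * ((1 / r) *\<^sub>R star x))"
      by (rule two_sided_unit_one_minus_swap[OF two_sided_unit_scaleR_iff[THEN iffD1, rotated]])
        (use r in simp)
    then have "two_sided_unit (r *\<^sub>R (1 - x * ((1 / r) *\<^sub>R star x)))"
      using r by (simp only: two_sided_unit_scaleR_iff)
    then show "two_sided_unit (t *\<^sub>R 1 + (M *\<^sub>R 1 - x * star x))"
      using r by (simp add: scaleR_diff_right) (simp add: r_def algebra_simps)
  qed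
  then have "pos ((star x * x + x * star x) + (M *\<^sub>R 1 - x * star x))"
    by (intro pos_add pos_star_mult_self_plus)
  then have "two_sided_unit ((s - M) *\<^sub>R 1 + ((star x * x + x * star x) + (M *\<^sub>R 1 - x * star x)))"
    using 0(3) by (intro posD(2)) auto
  then show ?case by (simp add: algebra_simps)
next
  case (Suc n)
  define h where "h = star x * x"
  have h: "star h = h" by (simp add: h_def star_mult star_star)
  define c where "c = 3 * M / 4"
  define y where "y = x * (c *\<^sub>R 1 - h)"
  have yy: "star y * y = (c *\<^sub>R 1 - h) * h * (c *\<^sub>R 1 - h)"
    by (simp add: y_def star_mult star_diff star_scaleR star_one h mult.assoc) (simp add: h_def mult.assoc)
  have upper: "two_sided_unit (t *\<^sub>R 1 - star y * y)" if t: "t > M ^ 3 / 16" for t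
  proof -
    \<comment> \<open>Solve p(r) = t so that \<open>cubic_factor\<close> applies. At the right
      endpoint r is at least 16 t / M^2 and r - c at least M/4, so p(r) is at least t.\<close>
    have "\<exists>r\<ge>M. r \<le> M + 16 * t / M\<^sup>2 \<and> r * (r - c)\<^sup>2 = t"
    proof (rule IVT')
      show "M * (M - c)\<^sup>2 \<le> t"
        using t by (simp add: c_def power2_eq_square power3_eq_cube)
      have tpos: "t > 0" using t Suc.prems(1) by (smt (verit) zero_less_divide_iff zero_less_power)
      show "M \<le> M + 16 * t / M\<^sup>2" using tpos by simp
      have "t = (16 * t / M\<^sup>2) * (M / 4)\<^sup>2"
        using Suc.prems(1) by (simp add: power2_eq_square)
      also have "\<dots> \<le> (M + 16 * t / M\<^sup>2) * (M + 16 * t / M\<^sup>2 - c)\<^sup>2"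
        using Suc.prems(1) tpos by (intro mult_mono power_mono) (auto simp: c_def)
      finally show "t \<le> (M + 16 * t / M\<^sup>2) * (M + 16 * t / M\<^sup>2 - c)\<^sup>2" .
      show "continuous_on {M..M + 16 * t / M\<^sup>2} (\<lambda>r. r * (r - c)\<^sup>2)"
        by (intro continuous_intros)
    qed
    then obtain r where r: "r \<ge> M" "r * (r - c)\<^sup>2 = t" by blast
    then have rM: "r > M"
      using t by (cases "r = M") (auto simp: c_def power2_eq_square power3_eq_cube)
    \<comment> \<open>Completing the square in the quadratic factor leaves the constant
      \<open>e\<close>, which is positive for all \<open>r > M\<close> because
      \<open>4 * c = 3 * M\<close>.\<close>
    define k where "k = h + ((r - 2 * c) / 2) *\<^sub>R 1"
    define e where "e = r * (3 * r - 4 * c) / 4"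
    have "e > 0" using rM Suc.prems(1) by (simp add: e_def c_def)
    moreover have "star k = k" by (simp add: k_def star_add star_scaleR star_one h)
    ultimately have "two_sided_unit (k * k + e *\<^sub>R 1)" by (intro unit_square_plus)
    moreover have "k * k + e *\<^sub>R 1 = h * h + (r - 2 * c) *\<^sub>R h + (r - c)\<^sup>2 *\<^sub>R 1"
    proof -
      have "k * k = h * h + (r - 2 * c) *\<^sub>R h + ((r - 2 * c) / 2)\<^sup>2 *\<^sub>R 1"
        by (simp add: k_def algebra_simps power2_eq_square flip: scaleR_add_left)
      moreover have "((r - 2 * c) / 2)\<^sup>2 + e = (r - c)\<^sup>2"
        by (simp add: e_def power2_eq_square field_simps)
      ultimately show ?thesis by (simp add: add.assoc flip: scaleR_add_left)
    qed
    ultimately have "two_sided_unit ((r *\<^sub>R 1 - h) * (h * h + (r - 2 * c) *\<^sub>R h + (r - c)\<^sup>2 *\<^sub>R 1))"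
      using Suc.prems(2)[OF rM] by (simp add: two_sided_unit_mult h_def)
    then have "two_sided_unit (- ((h - r *\<^sub>R 1) * (h * h + (r - 2 * c) *\<^sub>R h + (r - c)\<^sup>2 *\<^sub>R 1)))"
      by (simp flip: mult_minus_left)
    then show ?thesis
      by (simp add: yy r(2) flip: cubic_factor(1))
  qed
  have sM: "s > M / 9 ^ Suc n" by fact
  then have s: "s > 0" using Suc.prems(1) by (smt (verit) zero_less_divide_iff zero_less_power)
  \<comment> \<open>The induction hypothesis for \<open>y\<close> has the upper bound
    \<open>M ^ 3 / 16\<close>. Its lower threshold is beaten by - p(-s) = s (s + c)^2, which is at
    least s c^2.\<close>
  have "M ^ 3 / 16 / 9 ^ n = (M / 9 ^ Suc n) * (9 * M\<^sup>2 / 16)"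
    by (simp add: power2_eq_square power3_eq_cube)
  also have "\<dots> < s * (9 * M\<^sup>2 / 16)"
    using sM Suc.prems(1) by (intro mult_strict_right_mono) auto
  also have "\<dots> = s * (3 * M / 4)\<^sup>2"
    by (simp add: power2_eq_square)
  also have "\<dots> \<le> s * (s + c)\<^sup>2"
    using s Suc.prems(1) by (intro mult_left_mono power_mono) (auto simp: c_def)
  finally have "two_sided_unit ((s * (s + c)\<^sup>2) *\<^sub>R 1 + star y * y)"
    using Suc.prems(1) upper by (intro Suc.IH[of "M ^ 3 / 16"]) auto
  moreover have "(- s - c)\<^sup>2 = (s + c)\<^sup>2"
    by (simp add: power2_eq_square algebra_simps)
  \<comment> \<open>This is \<open>cubic_factor\<close> at \<open>r = - s\<close>, whose linear
    factor is the element to be inverted.\<close>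
  then have "(s * (s + c)\<^sup>2) *\<^sub>R 1 + star y * y =
      (h - (- s) *\<^sub>R 1) * (h * h + (- s - 2 * c) *\<^sub>R h + (- s - c)\<^sup>2 *\<^sub>R 1)"
    unfolding yy cubic_factor(1)[symmetric] by simp
  ultimately have "two_sided_unit (h - (- s) *\<^sub>R 1)"
    by (metis two_sided_unit_factor cubic_factor(2))
  then show ?case by (simp add: h_def add.commute)
qed

text \<open>Enough improvements by the factor 9 bring the threshold below
  \<open>s = 1\<close>.\<close>

lemma two_sided_unit_one_plus_star_mult_self: "two_sided_unit (1 + star x * x)"
proof -
  define M where "M = 1 + (norm x)\<^sup>2"
  have M: "M > 0" by (simp add: M_def add_pos_nonneg)
  obtain n where "M < 9 ^ n"
    using real_arch_pow[of 9 M] by auto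
  then have n: "M / 9 ^ n < 1" by simp
  have "two_sided_unit (t *\<^sub>R 1 - star x * x)" if "t > M" for t
    using that by (intro two_sided_unit_scaleR_one_minus) (simp add: cstar_identity M_def)
  from two_sided_unit_plus_star_mult_self_gt[OF M this n] show ?thesis by simp
qed

end

sublocale unital_complex_cstar_algebra \<subseteq> real: unital_real_cstar_algebra star
  by unfold_locales (rule star_scaleR two_sided_unit_one_plus_star_mult_self)+

section \<open>Complex positivity, complex states and their real parts\<close>

context unital_complex_cstar_algebra
begin

lemma complex_positive_iff: "complex_positive scaleC star h \<longleftrightarrow> pos h"
proof
  assume h: "complex_positive scaleC star h"
  show "pos h"
    unfolding pos_def
  proof (intro conjI allI impI)
    show "star h = h" using h by (simp add: complex_positive_def)
    fix t :: real assume "t > 0"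
    then have "complex_of_real (- t) \<notin> complex_spectrum scaleC h"
      using h by (auto simp: complex_positive_def complex_nonneg_Reals_iff dest!: subsetD)
    then show "two_sided_unit (t *\<^sub>R 1 + h)"
      unfolding complex_spectrum_def by (simp add: scaleC_of_real add.commute del: of_real_minus)
  qed
next
  assume h: "pos h"
  show "complex_positive scaleC star h"
    unfolding complex_positive_def
  proof (intro conjI subsetI)
    show sa: "star h = h" by (rule posD(1)[OF h])
    fix z assume z: "z \<in> complex_spectrum scaleC h"
    define k where "k = h - Re z *\<^sub>R 1"
    have k: "star k = k" by (simp add: k_def star_diff star_scaleR star_one sa)
    have "scaleC z 1 = Re z *\<^sub>R 1 + Im z *\<^sub>R scaleC \<i> 1"
      by (subst complex_eq[of z]) (simp add: scale_left_distrib mult.commute flip: scaleC_of_real)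
    then have nu: "\<not> two_sided_unit (k - Im z *\<^sub>R scaleC \<i> 1)"
      using z by (simp add: complex_spectrum_def k_def diff_diff_eq)
    \<comment> \<open>The product in both orders is needed, since only a commuting factor of a unit
      is inferred to be a unit.\<close>
    have "(k - Im z *\<^sub>R scaleC \<i> 1) * (k + Im z *\<^sub>R scaleC \<i> 1) = k * k + (Im z)\<^sup>2 *\<^sub>R 1"
      "(k + Im z *\<^sub>R scaleC \<i> 1) * (k - Im z *\<^sub>R scaleC \<i> 1) = k * k + (Im z)\<^sup>2 *\<^sub>R 1"
      by (simp_all add: algebra_simps scaleC_mult_left scaleC_mult_right scaleC_scaleR scaleC_ii_ii
          power2_eq_square)
    then have "\<not> two_sided_unit (k * k + (Im z)\<^sup>2 *\<^sub>R 1)"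
      using nu by (metis two_sided_unit_factor)
    then have Im: "Im z = 0"
      using unit_square_plus[OF k, of "(Im z)\<^sup>2"] by auto
    moreover have "Re z \<ge> 0"
    proof (rule ccontr)
      assume "\<not> Re z \<ge> 0"
      then have "two_sided_unit k"
        using posD(2)[OF h, of "- Re z"] by (simp add: k_def add.commute)
      then show False using nu Im by simp
    qed
    ultimately show "z \<in> \<real>\<^sub>\<ge>\<^sub>0" by (simp add: complex_nonneg_Reals_iff)
  qed
qed

text \<open>Invariance under \<open>star\<close> has to be derived. Positivity of
  \<open>norm h *\<^sub>R 1 - h\<close> makes \<phi> real at selfadjoint \<open>h\<close>; applied
  to \<open>scaleC \<i> (star c - c)\<close> this equates the real parts at \<open>c\<close> and
  \<open>star c\<close>.\<close>

lemma real_state_Re: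
  assumes "complex_state scaleC star \<phi>"
  shows "real_state star (\<lambda>x. Re (\<phi> x))"
proof -
  interpret \<phi>: Vector_Spaces.linear scaleC "(*)" \<phi>
    using assms by (simp add: complex_state_def)
  have one: "\<phi> 1 = 1" and pos: "\<And>h. pos h \<Longrightarrow> \<phi> h \<in> \<real>\<^sub>\<ge>\<^sub>0"
    using assms by (simp_all add: complex_state_def complex_positive_iff)
  have scaleR: "\<phi> (r *\<^sub>R x) = r * \<phi> x" for r x
    using \<phi>.scale[of "complex_of_real r" x] by (simp add: scaleC_of_real)
  have Im: "Im (\<phi> h) = 0" if "star h = h" for h
    using pos[OF pos_norm_minus[OF that]]
    by (simp add: \<phi>.diff scaleR one complex_nonneg_Reals_iff)
  have "Re (\<phi> (star c)) = Re (\<phi> c)" for c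
  proof -
    have "star (scaleC \<i> (star c - c)) = scaleC \<i> (star c - c)"
      by (simp add: star_scaleC star_diff star_star scale_minus_left flip: scale_minus_right)
    from Im[OF this] show ?thesis by (simp add: \<phi>.scale \<phi>.diff)
  qed
  moreover have "linear (\<lambda>x. Re (\<phi> x))"
    by (rule linearI) (simp_all add: \<phi>.add scaleR)
  ultimately show ?thesis
    using one pos by (auto simp: real_state_def real_positive_iff complex_nonneg_Reals_iff)
qed

text \<open>The usual complex-linear functional f(x) - i f(i x) with real part \<open>f\<close>. Its
  imaginary part vanishes at selfadjoint \<open>h\<close> because \<open>star\<close> negates
  \<open>scaleC \<i> h\<close> while \<open>f\<close> is invariant under
  \<open>star\<close>.\<close>

lemma complex_state_of_real_state:
  assumes f: "real_state star f"
  defines "\<phi> \<equiv> \<lambda>x. Complex (f x) (- f (scaleC \<i> x))"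
  shows "complex_state scaleC star \<phi>" and "\<And>h. star h = h \<Longrightarrow> \<phi> h = complex_of_real (f h)"
proof -
  have lin: "linear f" and star: "\<And>c. f (star c) = f c"
    using f by (simp_all add: real_state_def)
  have sa: "\<phi> h = complex_of_real (f h)" if "star h = h" for h
  proof -
    have "f (scaleC \<i> h) = - f (scaleC \<i> h)"
      using star[of "scaleC \<i> h"] that by (simp add: star_scaleC scale_minus_left linear_neg[OF lin])
    then show ?thesis by (simp add: \<phi>_def complex_eq_iff)
  qed
  then show "\<And>h. star h = h \<Longrightarrow> \<phi> h = complex_of_real (f h)" .
  have add: "\<phi> (x + y) = \<phi> x + \<phi> y" for x y
    by (simp add: \<phi>_def linear_add[OF lin] scale_right_distrib complex_eq_iff)
  have scale: "\<phi> (scaleC c x) = c * \<phi> x" for c x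
  proof -
    have c: "scaleC c x = Re c *\<^sub>R x + Im c *\<^sub>R scaleC \<i> x" for x
      by (subst complex_eq[of c]) (simp add: scale_left_distrib mult.commute flip: scaleC_of_real)
    have ic: "scaleC \<i> (scaleC c x) = Re c *\<^sub>R scaleC \<i> x - Im c *\<^sub>R x"
      by (simp add: c scale_right_distrib scaleC_scaleR scaleC_ii_ii)
    show ?thesis
      unfolding \<phi>_def ic
      by (simp add: c linear_add[OF lin] linear_diff[OF lin] linear_scale[OF lin] complex_eq_iff algebra_simps)
  qed
  have "Vector_Spaces.linear scaleC (*) \<phi>"
    by unfold_locales (simp_all add: add scale algebra_simps)
  moreover have "\<phi> h \<in> \<real>\<^sub>\<ge>\<^sub>0" if "pos h" for h
    using f that by (simp add: sa posD(1) real_state_def real_positive_iff)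
  moreover have "\<phi> 1 = 1"
    using f by (simp add: sa star_one real_state_def)
  ultimately show "complex_state scaleC star \<phi>"
    by (simp add: complex_state_def complex_positive_iff)
qed

lemma best_approximation_iff_complex_state:
  assumes B: "module.subspace scaleC B" and b0: "b\<^sub>0 \<in> B"
  shows "best_approximation a B b\<^sub>0 \<longleftrightarrow>
    (\<exists>\<phi>. complex_state scaleC star \<phi> \<and>
      \<phi> (star (a - b\<^sub>0) * (a - b\<^sub>0)) = complex_of_real ((norm (a - b\<^sub>0))\<^sup>2) \<and>
      (\<forall>b\<in>B. \<phi> (star a * b) = \<phi> (star b\<^sub>0 * b)))"
    (is "_ \<longleftrightarrow> ?R")
proof -
  have "Real_Vector_Spaces.subspace B"
    using subspace_0[OF B] subspace_add[OF B] subspace_scale[OF B]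
    by (auto simp: Real_Vector_Spaces.subspace_def simp flip: scaleC_of_real)
  note best = real.best_approximation_iff_real_state[OF this b0, of a]
  show ?thesis
    unfolding best
  proof
    assume "\<exists>f. real_state star f \<and> f (star (a - b\<^sub>0) * (a - b\<^sub>0)) = (norm (a - b\<^sub>0))\<^sup>2 \<and>
      (\<forall>b\<in>B. f (star a * b) = f (star b\<^sub>0 * b))"
    then obtain f where f: "real_state star f" "f (star (a - b\<^sub>0) * (a - b\<^sub>0)) = (norm (a - b\<^sub>0))\<^sup>2"
      and eq: "\<And>b. b \<in> B \<Longrightarrow> f (star a * b) = f (star b\<^sub>0 * b)"
      by blast
    \<comment> \<open>The imaginary parts agree because \<open>B\<close> is a complex subspace: the
      real condition is applied to \<open>scaleC \<i> b\<close>.\<close>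
    have "f (scaleC \<i> (star a * b)) = f (scaleC \<i> (star b\<^sub>0 * b))" if "b \<in> B" for b
      using eq[OF subspace_scale[OF B that, of \<i>]] by (simp add: scaleC_mult_right)
    moreover have "star (star (a - b\<^sub>0) * (a - b\<^sub>0)) = star (a - b\<^sub>0) * (a - b\<^sub>0)"
      by (simp add: star_mult star_star)
    then have "Complex (f (star (a - b\<^sub>0) * (a - b\<^sub>0))) (- f (scaleC \<i> (star (a - b\<^sub>0) * (a - b\<^sub>0)))) =
        complex_of_real ((norm (a - b\<^sub>0))\<^sup>2)"
      using complex_state_of_real_state(2)[OF f(1)] f(2) by metis
    ultimately show ?R
      using complex_state_of_real_state(1)[OF f(1)] eq
      by (intro exI[of _ "\<lambda>x. Complex (f x) (- f (scaleC \<i> x))"]) auto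
  next
    assume ?R
    then obtain \<phi> where "complex_state scaleC star \<phi>"
      "\<phi> (star (a - b\<^sub>0) * (a - b\<^sub>0)) = complex_of_real ((norm (a - b\<^sub>0))\<^sup>2)"
      "\<forall>b\<in>B. \<phi> (star a * b) = \<phi> (star b\<^sub>0 * b)"
      by blast
    then show "\<exists>f. real_state star f \<and> f (star (a - b\<^sub>0) * (a - b\<^sub>0)) = (norm (a - b\<^sub>0))\<^sup>2 \<and>
      (\<forall>b\<in>B. f (star a * b) = f (star b\<^sub>0 * b))"
      by (intro exI[of _ "\<lambda>x. Re (\<phi> x)"]) (simp add: real_state_Re)
  qed
qed

end

theorem theorem1p1:
  fixes star :: "'a::{real_normed_algebra_1,banach} \<Rightarrow> 'a"
    and scaleC :: "complex \<Rightarrow> 'a \<Rightarrow> 'a"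
    and a b\<^sub>0 :: 'a and B :: "'a set"
  assumes "b\<^sub>0 \<in> B"
  shows
    "(unital_real_cstar_algebra star \<and> subspace B \<longrightarrow>
        (best_approximation a B b\<^sub>0 \<longleftrightarrow>
          (\<exists>\<phi>. real_state star \<phi> \<and>
               \<phi> (star (a - b\<^sub>0) * (a - b\<^sub>0)) = (norm (a - b\<^sub>0))\<^sup>2 \<and>
               (\<forall>b\<in>B. \<phi> (star a * b) = \<phi> (star b\<^sub>0 * b))))) \<and>
     (unital_complex_cstar_algebra scaleC star \<and> module.subspace scaleC B \<longrightarrow>
        (best_approximation a B b\<^sub>0 \<longleftrightarrow>
          (\<exists>\<phi>. complex_state scaleC star \<phi> \<and>
               \<phi> (star (a - b\<^sub>0) * (a - b\<^sub>0)) = complex_of_real ((norm (a - b\<^sub>0))\<^sup>2) \<and>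
               (\<forall>b\<in>B. \<phi> (star a * b) = \<phi> (star b\<^sub>0 * b)))))"
  using unital_real_cstar_algebra.best_approximation_iff_real_state[of star B b\<^sub>0 a]
    unital_complex_cstar_algebra.best_approximation_iff_complex_state[of scaleC star B b\<^sub>0 a] assms
  by blast

end
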